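(* There is a finite presentation $P$ of a group with solvable word problem (namely, the Baumslag--Solitar presentation $P=\mathrm{BS}(2,3)=\langle s,t\mid s^{-1}t^{2}s=t^{3}\rangle$) for which there is no algorithm that, on input of a recursive presentation $Q$ such that $\overline{P}\cong\overline{Q}$, outputs a recursive enumeration of Tietze transformations of type $(\mathrm{T}1)$ and $(\mathrm{T}2)$ (manipulation of relators), and a finite set of Tietze transformations of type $(\mathrm{T}3)$ and $(\mathrm{T}4)$ (addition and removal of generators), transforming $P$ to $Q$.
   Context: Notation: for a group presentation $P=\langle X\mid R\rangle$, $\overline{P}$ denotes the group presented by $P$. A presentation $\langle Y\mid S\rangle$ is a recursive presentation if $Y$ is a finite set and $S$ is a recursive enumeration of relators (words on $Y\cup Y^{-1}$); such a presentation is given as input to an algorithm by $Y$ together with a description of a machine enumerating $S$. Tietze transformations of a presentation (following the notation of Magnus--Karrass--Solitar) are the following: $(\mathrm{T}1)$ add to the relators words that are consequences of the existing relators; $(\mathrm{T}2)$ delete from the relators words that are consequences of the remaining relators; $(\mathrm{T}3)$ add new generators $x,y,\dots$ together with relations $x=K$, $y=M,\dots$, where $K,M,\dots$ are words in the existing generators; $(\mathrm{T}4)$ if some of the relations have the form $p=V$, $q=W,\dots$ with $p,q,\dots$ generators and $V,W,\dots$ words in the generators other than $p,q,\dots$, delete $p,q,\dots$ from the generators, delete these relations, and replace $p,q,\dots$ by $V,W,\dots$ in the remaining relators. Each transformation carries an explicit isomorphism between the groups presented before and after: for $(\mathrm{T}1)$, $(\mathrm{T}2)$ it is the identity on generators;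 for $(\mathrm{T}3)$ it is the inclusion of the old generators; for $(\mathrm{T}4)$ it sends $p,q,\dots$ to $V,W,\dots$ and fixes the other generators. The output consists of a recursively enumerated (possibly infinite) sequence of transformations in which only finitely many are of type $(\mathrm{T}3)$ or $(\mathrm{T}4)$, these finitely many being given explicitly as a finite set. The sequence is a way of specifying an isomorphism from $\overline{P}$ to $\overline{Q}$: saying that it transforms $P$ to $Q$ means that applying the transformations successively starting from $P$ results in $Q$, and that the composite of the associated maps on generators (which changes only at the finitely many $(\mathrm{T}3)$ and $(\mathrm{T}4)$ steps) extends to an isomorphism $\overline{P}\to\overline{Q}$. *)

theory Defs
  imports Complex_Main "HOL-Library.Nat_Bijection" "HOL-Algebra.Group"
begin

section \<open>Words and group presentations\<close>

text \<open>The letter \<open>(x, True)\<close> is the generator \<open>x\<close> and \<open>(x, False)\<close> is its inverse.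
  Words are strings of letters, not necessarily freely reduced.\<close>

type_synonym 'a letter = "'a \<times> bool"
type_synonym 'a word = "'a letter list"

definition words :: "'a set \<Rightarrow> 'a word set" where
  "words X = lists (X \<times> UNIV)"

abbreviation gen_word :: "'a \<Rightarrow> 'a word" where
  "gen_word x \<equiv> [(x, True)]"

definition inv_letter :: "'a letter \<Rightarrow> 'a letter" where
  "inv_letter a = (fst a, \<not> snd a)"

definition inv_word :: "'a word \<Rightarrow> 'a word" where
  "inv_word w = rev (map inv_letter w)"

definition subst :: "('a \<Rightarrow> 'b word) \<Rightarrow> 'a word \<Rightarrow> 'b word" where
  "subst f w = concat (map (\<lambda>(x, b). if b then f x else inv_word (f x)) w)"

datatype 'a presentation = Presentation (gens: "'a set") (rels: "'a word set")

definition finite_presentation :: "'a presentation \<Rightarrow> bool" where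
  "finite_presentation P \<longleftrightarrow> finite (gens P) \<and> finite (rels P) \<and> rels P \<subseteq> words (gens P)"

text \<open>As in Magnus, Karrass and Solitar, two words define the same element of the presented group
  iff one can be transformed into the other by inserting and deleting relators and
  trivial relators \<open>x x\<^sup>-\<^sup>1\<close>, \<open>x\<^sup>-\<^sup>1 x\<close>.\<close>

inductive word_equiv :: "'a presentation \<Rightarrow> 'a word \<Rightarrow> 'a word \<Rightarrow> bool" for P where
  refl: "u \<in> words (gens P) \<Longrightarrow> word_equiv P u u"
| sym: "word_equiv P u v \<Longrightarrow> word_equiv P v u"
| trans: "word_equiv P u v \<Longrightarrow> word_equiv P v w \<Longrightarrow> word_equiv P u w"
| trivial: "u @ v \<in> words (gens P) \<Longrightarrow> fst a \<in> gens P \<Longrightarrow>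
    word_equiv P (u @ [a, inv_letter a] @ v) (u @ v)"
| relator: "u @ v \<in> words (gens P) \<Longrightarrow> r \<in> rels P \<Longrightarrow> word_equiv P (u @ r @ v) (u @ v)"

definition word_class :: "'a presentation \<Rightarrow> 'a word \<Rightarrow> 'a word set" where
  "word_class P w = {v. word_equiv P w v}"

definition presented_group :: "'a presentation \<Rightarrow> 'a word set monoid" where
  "presented_group P =
    \<lparr>carrier = word_class P ` words (gens P),
     monoid.mult = (\<lambda>A B. \<Union>a\<in>A. \<Union>b\<in>B. word_class P (a @ b)),
     one = word_class P []\<rparr>"

definition consequence :: "'a presentation \<Rightarrow> 'a word \<Rightarrow> bool" where
  "consequence P w \<longleftrightarrow>
    w \<in> words (gens P) \<and> word_class P w = \<one>\<^bsub>presented_group P\<^esub>"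

definition extends_to_iso ::
    "'a presentation \<Rightarrow> 'a presentation \<Rightarrow> ('a \<Rightarrow> 'a word) \<Rightarrow> bool" where
  "extends_to_iso P Q f \<longleftrightarrow>
    (\<exists>h \<in> iso (presented_group P) (presented_group Q).
       \<forall>x \<in> gens P. h (word_class P (gen_word x)) = word_class Q (f x))"

text \<open>\<open>BS(m, n) = \<langle>s, t | s\<^sup>-\<^sup>1 t\<^sup>m s = t\<^sup>n\<rangle>\<close>, with \<open>s = 0\<close> and \<open>t = 1\<close>;
  the relation \<open>u = v\<close> is the relator \<open>u v\<^sup>-\<^sup>1\<close>.\<close>

definition baumslag_solitar :: "nat \<Rightarrow> nat \<Rightarrow> nat presentation" where
  "baumslag_solitar m n = Presentation {0, 1}
    {([(0, False)] @ replicate m (1, True) @ [(0, True)]) @ inv_word (replicate n (1, True))}"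


section \<open>Tietze transformations\<close>

text \<open>An entry \<open>(x, K)\<close> of the list of a T3 or T4 transformation stands for the relation
  \<open>x = K\<close>, that is, for the relator \<open>x K\<^sup>-\<^sup>1\<close>.\<close>

datatype 'a tietze =
    T1 "'a word list"
  | T2 "'a word list"
  | T3 "('a \<times> 'a word) list"
  | T4 "('a \<times> 'a word) list"

fun changes_generators :: "'a tietze \<Rightarrow> bool" where
  "changes_generators (T1 ws) = False"
| "changes_generators (T2 ws) = False"
| "changes_generators (T3 ds) = True"
| "changes_generators (T4 ds) = True"

definition def_relators :: "('a \<times> 'a word) list \<Rightarrow> 'a word set" where
  "def_relators ds = (\<lambda>(x, K). gen_word x @ inv_word K) ` set ds"

definition replace_gens :: "('a \<times> 'a word) list \<Rightarrow> 'a \<Rightarrow> 'a word" where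
  "replace_gens ds x = (case map_of ds x of Some V \<Rightarrow> V | None \<Rightarrow> gen_word x)"

fun applicable :: "'a tietze \<Rightarrow> 'a presentation \<Rightarrow> bool" where
  "applicable (T1 ws) (Presentation X R) \<longleftrightarrow>
    (\<forall>w \<in> set ws. consequence (Presentation X R) w)"
| "applicable (T2 ws) (Presentation X R) \<longleftrightarrow>
    set ws \<subseteq> R \<and> (\<forall>w \<in> set ws. consequence (Presentation X (R - set ws)) w)"
| "applicable (T3 ds) (Presentation X R) \<longleftrightarrow>
    distinct (map fst ds) \<and> fst ` set ds \<inter> X = {} \<and> snd ` set ds \<subseteq> words X"
| "applicable (T4 ds) (Presentation X R) \<longleftrightarrow>
    distinct (map fst ds) \<and> fst ` set ds \<subseteq> X \<and> snd ` set ds \<subseteq> words (X - fst ` set ds) \<and>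
    def_relators ds \<subseteq> R"

fun apply_tietze :: "'a tietze \<Rightarrow> 'a presentation \<Rightarrow> 'a presentation" where
  "apply_tietze (T1 ws) (Presentation X R) = Presentation X (R \<union> set ws)"
| "apply_tietze (T2 ws) (Presentation X R) = Presentation X (R - set ws)"
| "apply_tietze (T3 ds) (Presentation X R) =
    Presentation (X \<union> fst ` set ds) (R \<union> def_relators ds)"
| "apply_tietze (T4 ds) (Presentation X R) =
    Presentation (X - fst ` set ds) (subst (replace_gens ds) ` (R - def_relators ds))"

text \<open>The image of each old generator under the isomorphism carried by a transformation.\<close>

fun tietze_map :: "'a tietze \<Rightarrow> 'a \<Rightarrow> 'a word" where
  "tietze_map (T1 ws) = gen_word"
| "tietze_map (T2 ws) = gen_word"
| "tietze_map (T3 ds) = gen_word"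
| "tietze_map (T4 ds) = replace_gens ds"

text \<open>A finite or infinite sequence is a partial function \<open>\<tau>\<close> on the natural numbers whose domain
  is an initial segment. \<open>stage P \<tau> n\<close> is the presentation after the first \<open>n\<close> transformations,
  and \<open>stage_map \<tau> n\<close> is the composite of their associated maps.\<close>

definition is_sequence :: "(nat \<rightharpoonup> 'a) \<Rightarrow> bool" where
  "is_sequence \<tau> \<longleftrightarrow> (\<forall>n. \<tau> n = None \<longrightarrow> \<tau> (Suc n) = None)"

primrec stage :: "'a presentation \<Rightarrow> (nat \<rightharpoonup> 'a tietze) \<Rightarrow> nat \<Rightarrow> 'a presentation" where
  "stage P \<tau> 0 = P"
| "stage P \<tau> (Suc n) =
    (case \<tau> n of None \<Rightarrow> stage P \<tau> n | Some t \<Rightarrow> apply_tietze t (stage P \<tau> n))"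

primrec stage_map :: "(nat \<rightharpoonup> 'a tietze) \<Rightarrow> nat \<Rightarrow> 'a \<Rightarrow> 'a word" where
  "stage_map \<tau> 0 = gen_word"
| "stage_map \<tau> (Suc n) =
    (case \<tau> n of None \<Rightarrow> stage_map \<tau> n | Some t \<Rightarrow> subst (tietze_map t) \<circ> stage_map \<tau> n)"

text \<open>The result of an infinite sequence is the limit of its stages: the generating set is
  eventually that of \<open>Q\<close>, and each word is eventually a relator or eventually not a relator,
  according to whether it is a relator of \<open>Q\<close>. That the limit map extends to an isomorphism is a
  separate requirement, since infinitely many T2 steps need not preserve the group in the limit.\<close>

definition transforms ::
    "'a presentation \<Rightarrow> (nat \<rightharpoonup> 'a tietze) \<Rightarrow> 'a presentation \<Rightarrow> bool" where
  "transforms P \<tau> Q \<longleftrightarrow>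
    is_sequence \<tau> \<and>
    finite {n. \<exists>t. \<tau> n = Some t \<and> changes_generators t} \<and>
    (\<forall>n t. \<tau> n = Some t \<longrightarrow> applicable t (stage P \<tau> n)) \<and>
    (\<forall>\<^sub>F n in sequentially. gens (stage P \<tau> n) = gens Q) \<and>
    (\<forall>w. \<forall>\<^sub>F n in sequentially. w \<in> rels (stage P \<tau> n) \<longleftrightarrow> w \<in> rels Q) \<and>
    (\<exists>f. (\<forall>\<^sub>F n in sequentially. stage_map \<tau> n = f) \<and> extends_to_iso P Q f)"


section \<open>Machines\<close>

text \<open>Kleene's partial recursive functions in one variable, with several arguments coded by the
  Cantor pairing function. \<open>Minim p\<close> is unbounded search for the least zero of \<open>p\<close> at which all
  smaller values are defined.\<close>

datatype machine =
    Zero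
  | Succ
  | Proj1
  | Proj2
  | Pairing machine machine
  | Compose machine machine
  | PrimRec machine machine
  | Minim machine

primrec run :: "machine \<Rightarrow> nat \<rightharpoonup> nat" where
  "run Zero = (\<lambda>x. Some 0)"
| "run Succ = (\<lambda>x. Some (Suc x))"
| "run Proj1 = (\<lambda>x. Some (fst (prod_decode x)))"
| "run Proj2 = (\<lambda>x. Some (snd (prod_decode x)))"
| "run (Pairing p q) = (\<lambda>x.
    Option.bind (run p x) (\<lambda>y. Option.bind (run q x) (\<lambda>z. Some (prod_encode (y, z)))))"
| "run (Compose p q) = (\<lambda>x. Option.bind (run q x) (run p))"
| "run (PrimRec p q) = (\<lambda>x. case prod_decode x of (a, n) \<Rightarrow>
    rec_nat (run p a)
      (\<lambda>k r. Option.bind r (\<lambda>y. run q (prod_encode (a, prod_encode (k, y))))) n)"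
| "run (Minim p) = (\<lambda>x.
    if \<exists>n. run p (prod_encode (x, n)) = Some 0 \<and> (\<forall>m<n. run p (prod_encode (x, m)) \<noteq> None)
    then Some (LEAST n. run p (prod_encode (x, n)) = Some 0)
    else None)"

primrec machine_code :: "machine \<Rightarrow> nat" where
  "machine_code Zero = prod_encode (0, 0)"
| "machine_code Succ = prod_encode (1, 0)"
| "machine_code Proj1 = prod_encode (2, 0)"
| "machine_code Proj2 = prod_encode (3, 0)"
| "machine_code (Pairing p q) = prod_encode (4, prod_encode (machine_code p, machine_code q))"
| "machine_code (Compose p q) = prod_encode (5, prod_encode (machine_code p, machine_code q))"
| "machine_code (PrimRec p q) = prod_encode (6, prod_encode (machine_code p, machine_code q))"
| "machine_code (Minim p) = prod_encode (7, machine_code p)"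

text \<open>The machine \<open>e\<close> enumerates a finite or infinite sequence if it outputs the code of
  the \<open>n\<close>-th item on input \<open>n\<close>, and diverges if there is no such item.\<close>

definition enumerates :: "machine \<Rightarrow> ('a \<Rightarrow> nat) \<Rightarrow> (nat \<rightharpoonup> 'a) \<Rightarrow> bool" where
  "enumerates e code \<tau> \<longleftrightarrow>
    is_sequence \<tau> \<and> (\<forall>n. run e n = map_option code (\<tau> n))"


section \<open>Algorithms on presentations\<close>

definition word_code :: "nat word \<Rightarrow> nat" where
  "word_code w = list_encode (map (\<lambda>(x, b). prod_encode (x, of_bool b)) w)"

definition words_code :: "nat word list \<Rightarrow> nat" where
  "words_code ws = list_encode (map word_code ws)"

definition defs_code :: "(nat \<times> nat word) list \<Rightarrow> nat" where
  "defs_code ds = list_encode (map (\<lambda>(x, K). prod_encode (x, word_code K)) ds)"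

fun tietze_code :: "nat tietze \<Rightarrow> nat" where
  "tietze_code (T1 ws) = prod_encode (1, words_code ws)"
| "tietze_code (T2 ws) = prod_encode (2, words_code ws)"
| "tietze_code (T3 ds) = prod_encode (3, defs_code ds)"
| "tietze_code (T4 ds) = prod_encode (4, defs_code ds)"

definition solvable_word_problem :: "nat presentation \<Rightarrow> bool" where
  "solvable_word_problem P \<longleftrightarrow>
    (\<exists>d. \<forall>w \<in> words (gens P).
       run d (word_code w) =
         Some (if word_class P w = \<one>\<^bsub>presented_group P\<^esub> then 1 else 0))"

definition recursive_presentation :: "nat presentation \<Rightarrow> machine \<Rightarrow> bool" where
  "recursive_presentation Q e \<longleftrightarrow>
    finite (gens Q) \<and> rels Q \<subseteq> words (gens Q) \<and>
    (\<exists>\<rho>. enumerates e word_code \<rho> \<and> ran \<rho> = rels Q)"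

definition presentation_code :: "nat presentation \<Rightarrow> machine \<Rightarrow> nat" where
  "presentation_code Q e =
    prod_encode (list_encode (sorted_list_of_set (gens Q)), machine_code e)"

text \<open>The number \<open>y\<close> specifies the sequence \<open>\<tau>\<close>: it consists of a machine enumerating \<open>\<tau>\<close> and an
  explicit list, in any order, of the T3 and T4 steps of \<open>\<tau>\<close> with their positions.\<close>

definition specifies_sequence :: "nat \<Rightarrow> (nat \<rightharpoonup> nat tietze) \<Rightarrow> bool" where
  "specifies_sequence y \<tau> \<longleftrightarrow>
    (\<exists>e L. y = prod_encode (machine_code e,
               list_encode (map (\<lambda>(n, t). prod_encode (n, tietze_code t)) L)) \<and>
       enumerates e tietze_code \<tau> \<and>
       set L = {(n, t). \<tau> n = Some t \<and> changes_generators t})"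

definition tietze_algorithm :: "nat presentation \<Rightarrow> machine \<Rightarrow> bool" where
  "tietze_algorithm P A \<longleftrightarrow>
    (\<forall>Q e. recursive_presentation Q e \<longrightarrow> presented_group P \<cong> presented_group Q \<longrightarrow>
       (\<exists>y \<tau>. run A (presentation_code Q e) = Some y \<and>
          specifies_sequence y \<tau> \<and> transforms P \<tau> Q))"

end

theory Submission
  imports Defs
begin

text \<open>BS(2,3) is not Hopfian, and this is played off against the algorithm by diagonalization.
  The endomorphism \<open>s \<mapsto> s\<close>, \<open>t \<mapsto> t\<^sup>2\<close> is surjective, and its kernel is the normal closure
  of one nontrivial word \<open>w\<close>; so \<open>P\<close> and \<open>P / w\<close> are isomorphic. Given a machine, a recursive
  presentation lists the relator of \<open>P\<close> and adds \<open>w\<close> if the machine halts on its own code.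
  From the T3 and T4 steps that the algorithm returns one computes words \<open>f(s)\<close>, \<open>f(t)\<close>
  inducing an isomorphism from \<open>P\<close> onto the presented group. If the machine does not halt, \<open>f\<close> is
  an automorphism of \<open>P\<close>, so some \<open>z \<noteq> 1\<close> in \<open>P\<close> satisfies \<open>f(z) = w\<close> in \<open>P\<close>. If it halts,
  there is no such \<open>z\<close>: \<open>f(z)\<close> would be trivial in \<open>P / w\<close>, where \<open>f\<close> is injective. As the word problem of \<open>P\<close>
  is solvable, \<open>z\<close> can be searched for, and the machine that does so, run on its own code,
  halts iff it does not.\<close>

section \<open>Computable functions\<close>

text \<open>Machines act on numbers only; an injective coding of each type lets computability be
  stated for typed functions. Pairs and lists are coded by \<open>prod_encode\<close> and
  \<open>list_encode\<close>, so that \<open>enc\<close> agrees with \<open>word_code\<close> and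
  \<open>defs_code\<close>.\<close>

class encodable =
  fixes enc :: "'a \<Rightarrow> nat"
  assumes enc_inject: "enc x = enc y \<longleftrightarrow> x = y"

instantiation nat :: encodable
begin
definition enc_nat :: "nat \<Rightarrow> nat" where "enc_nat n = n"
instance by standard (simp add: enc_nat_def)
end

instantiation bool :: encodable
begin
definition enc_bool :: "bool \<Rightarrow> nat" where "enc_bool b = of_bool b"
instance by standard (simp add: enc_bool_def)
end

instantiation prod :: (encodable, encodable) encodable
begin
definition enc_prod :: "'a \<times> 'b \<Rightarrow> nat" where "enc_prod z = prod_encode (enc (fst z), enc (snd z))"
instance by standard (auto simp add: enc_prod_def enc_inject prod_eq_iff)
end

instantiation list :: (encodable) encodable
begin
definition enc_list :: "'a list \<Rightarrow> nat" where "enc_list xs = list_encode (map enc xs)"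
instance
  by standard (metis enc_list_def enc_inject injI inj_map_eq_map list_encode_eq)
end

text \<open>Nonnegative integers receive the even codes and negative ones the odd codes, so the
  parity of a code tells the sign.\<close>

instantiation int :: encodable
begin
definition enc_int :: "int \<Rightarrow> nat" where
  "enc_int i = (if 0 \<le> i then 2 * nat i else 2 * nat (- i) - 1)"
instance
proof
  fix x y :: int
  show "enc x = enc y \<longleftrightarrow> x = y"
  proof
    assume *: "enc x = enc y"
    have odd: "odd (2 * nat (- b) - 1)" if "b < 0" for b :: int
      using that by (simp add: even_diff_nat)
    show "x = y"
    proof (cases "0 \<le> x"; cases "0 \<le> y")
      assume "0 \<le> x" "\<not> 0 \<le> y"
      then show ?thesis using * odd[of y] by (metis enc_int_def dvd_triv_left not_le)
    next
      assume "\<not> 0 \<le> x" "0 \<le> y"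
      then show ?thesis using * odd[of x] by (metis enc_int_def dvd_triv_left not_le)
    qed (use * in \<open>auto simp: enc_int_def\<close>)
  qed simp
qed
end

lemma enc_Pair: "enc (x, y) = prod_encode (enc x, enc y)"
  by (simp add: enc_prod_def)

lemma enc_Nil: "enc [] = 0"
  by (simp add: enc_list_def)

lemma enc_Cons: "enc (x # xs) = Suc (prod_encode (enc x, enc xs))"
  by (simp add: enc_list_def)

text \<open>Lets the code of a list serve as a computable number of rounds for a recursion that
  traverses the list.\<close>

lemma length_le_enc: "length xs \<le> enc xs"
  by (induction xs) (auto simp: enc_Nil enc_Cons intro: le_trans[OF _ le_prod_encode_2])

lemma enc_le_enc_list: "x \<in> set xs \<Longrightarrow> enc x \<le> enc xs"
  by (induction xs)
    (auto simp: enc_Cons intro: le_SucI[OF le_prod_encode_1] le_SucI[OF le_trans[OF _ le_prod_encode_2]])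

lemma word_code_eq_enc: "word_code w = enc w"
  by (simp add: word_code_def enc_list_def enc_prod_def enc_nat_def enc_bool_def split_def cong: map_cong)

section \<open>Total computable functions and their basic closure properties\<close>

definition computes :: "machine \<Rightarrow> ('a::encodable \<Rightarrow> 'b::encodable) \<Rightarrow> bool" where
  "computes e f \<longleftrightarrow> (\<forall>x. run e (enc x) = Some (enc (f x)))"

definition computable :: "('a::encodable \<Rightarrow> 'b::encodable) \<Rightarrow> bool" where
  "computable f \<longleftrightarrow> (\<exists>e. computes e f)"

lemma computableI: "(\<And>x. run e (enc x) = Some (enc (f x))) \<Longrightarrow> computable f"
  unfolding computable_def computes_def by blast

lemma computableE:
  assumes "computable f"
  obtains e where "\<And>x. run e (enc x) = Some (enc (f x))"
  using assms unfolding computable_def computes_def by blast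

lemma computable_id: "computable (\<lambda>x. x)"
  by (rule computableI[of "Pairing Proj1 Proj2"]) simp

primrec const_machine :: "nat \<Rightarrow> machine" where
  "const_machine 0 = Zero"
| "const_machine (Suc k) = Compose Succ (const_machine k)"

lemma run_const_machine [simp]: "run (const_machine k) x = Some k"
  by (induction k) auto

lemma computable_const: "computable (\<lambda>x. c)"
  by (rule computableI[of "const_machine (enc c)"]) simp

lemma computable_compose:
  assumes "computable f" "computable g"
  shows "computable (\<lambda>x. f (g x))"
proof -
  obtain p where p: "\<And>x. run p (enc x) = Some (enc (f x))" using computableE[OF assms(1)] by blast
  obtain q where q: "\<And>x. run q (enc x) = Some (enc (g x))" using computableE[OF assms(2)] by blast
  show ?thesis by (rule computableI[of "Compose p q"]) (simp add: p q)
qed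

lemma computable_Pair:
  assumes "computable f" "computable g"
  shows "computable (\<lambda>x. (f x, g x))"
proof -
  obtain p where p: "\<And>x. run p (enc x) = Some (enc (f x))" using computableE[OF assms(1)] by blast
  obtain q where q: "\<And>x. run q (enc x) = Some (enc (g x))" using computableE[OF assms(2)] by blast
  show ?thesis by (rule computableI[of "Pairing p q"]) (simp add: p q enc_Pair)
qed

lemma computable_fst':  "computable fst"
  by (rule computableI[of Proj1]) (simp add: enc_prod_def)

lemma computable_snd': "computable snd"
  by (rule computableI[of Proj2]) (simp add: enc_prod_def)

lemma computable_Suc': "computable Suc"
  by (rule computableI[of Succ]) (simp add: enc_nat_def)

lemmas computable_fst = computable_compose[OF computable_fst']
lemmas computable_snd = computable_compose[OF computable_snd']
lemmas computable_Suc = computable_compose[OF computable_Suc']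

lemma computable_rec_nat:
  assumes f: "computable f" and g: "computable (\<lambda>(x, k, r). g x k r)" and n: "computable n"
  shows "computable (\<lambda>x. rec_nat (f x) (g x) (n x))"
proof -
  obtain p where p: "\<And>x. run p (enc x) = Some (enc (f x))" using computableE[OF f] by blast
  obtain q where q: "\<And>x. run q (enc x) = Some (enc (case x of (x, k, r) \<Rightarrow> g x k r))"
    using computableE[OF g] by blast
  obtain m where m: "\<And>x. run m (enc x) = Some (enc (n x))" using computableE[OF n] by blast
  have "rec_nat (run p (enc x))
      (\<lambda>k r. Option.bind r (\<lambda>y. run q (prod_encode (enc x, prod_encode (k, y))))) k
      = Some (enc (rec_nat (f x) (g x) k))" for x k
  proof (induction k)
    case (Suc k)
    show ?case
      using q[of "(x, k, rec_nat (f x) (g x) k)"] Suc by (simp add: enc_Pair enc_nat_def)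
  qed (simp add: p)
  \<comment> \<open>\<open>Pairing Proj1 Proj2\<close> decodes a pair and encodes it again, so it is
    the identity machine: the recursion gets the whole input as parameter and \<open>n x\<close> as
    the number of rounds.\<close>
  then show ?thesis
    by (intro computableI[of "Compose (PrimRec p q) (Pairing (Pairing Proj1 Proj2) m)"])
      (simp add: m enc_nat_def)
qed

lemma computable_If:
  assumes "computable b" "computable f" "computable g"
  shows "computable (\<lambda>x. if b x then f x else g x)"
proof -
  obtain c where c: "\<And>x. run c (enc x) = Some (enc (b x))" using computableE[OF assms(1)] by blast
  obtain p where p: "\<And>x. run p (enc x) = Some (enc (f x))" using computableE[OF assms(2)] by blast
  obtain q where q: "\<And>x. run q (enc x) = Some (enc (g x))" using computableE[OF assms(3)] by blast
  \<comment> \<open>Truth values have the codes 0 and 1. The base case of the recursion runs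
    \<open>q\<close>; its only possible round discards that value and runs \<open>p\<close> on the
    parameter.\<close>
  show ?thesis
    by (rule computableI[of "Compose (PrimRec q (Compose p Proj1)) (Pairing (Pairing Proj1 Proj2) c)"])
      (simp add: c p q enc_bool_def)
qed

lemma computable_eq_0:
  assumes "computable (n :: 'a::encodable \<Rightarrow> nat)"
  shows "computable (\<lambda>x. n x = 0)"
proof -
  have "computable (\<lambda>x. rec_nat True (\<lambda>_ _. False) (n x))"
    by (intro computable_rec_nat computable_const assms) (simp add: split_def computable_const)
  moreover have "(\<lambda>x. rec_nat True (\<lambda>_ _. False) (n x)) = (\<lambda>x. n x = 0)"
    by (rule ext, case_tac "n x") auto
  ultimately show ?thesis by simp
qed

lemma computable_not: "computable b \<Longrightarrow> computable (\<lambda>x. \<not> b x)"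
  using computable_If[of b "\<lambda>_. False" "\<lambda>_. True"] by (simp add: computable_const if_bool_eq_conj)

lemma computable_conj: "computable b \<Longrightarrow> computable c \<Longrightarrow> computable (\<lambda>x. b x \<and> c x)"
  using computable_If[of b c "\<lambda>_. False"] by (simp add: computable_const if_bool_eq_disj)

lemmas computable_basic = computable_id computable_const computable_Pair computable_fst
  computable_snd computable_Suc computable_If computable_eq_0 computable_not computable_conj

section \<open>Arithmetic of natural numbers, and equality\<close>

lemma computable_pred:
  assumes "computable n"
  shows "computable (\<lambda>x. n x - 1 :: nat)"
proof -
  have "computable (\<lambda>x. rec_nat 0 (\<lambda>k _. k) (n x))"
    by (intro computable_rec_nat assms) (auto simp add: split_def intro!: computable_basic)
  moreover have "(\<lambda>x. rec_nat 0 (\<lambda>k _. k) (n x)) = (\<lambda>x. n x - 1)"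
    by (rule ext, case_tac "n x") auto
  ultimately show ?thesis by simp
qed

lemma computable_plus:
  assumes "computable m" "computable n"
  shows "computable (\<lambda>x. m x + n x :: nat)"
proof -
  have "computable (\<lambda>x. rec_nat (m x) (\<lambda>_ k. Suc k) (n x))"
    by (intro computable_rec_nat assms) (auto simp add: split_def intro!: computable_basic)
  moreover have "rec_nat a (\<lambda>_ k. Suc k) b = a + b" for a b
    by (induction b) auto
  ultimately show ?thesis by simp
qed

lemma computable_minus:
  assumes "computable m" "computable n"
  shows "computable (\<lambda>x. m x - n x :: nat)"
proof -
  have "computable (\<lambda>x. rec_nat (m x) (\<lambda>_ k. k - 1) (n x))"
    by (intro computable_rec_nat assms)
      (auto simp add: split_def simp del: One_nat_def intro!: computable_basic computable_pred)
  moreover have "rec_nat a (\<lambda>_ k. k - 1) b = a - b" for a b :: nat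
    by (induction b) auto
  ultimately show ?thesis by simp
qed

lemma computable_times:
  assumes "computable m" "computable n"
  shows "computable (\<lambda>x. m x * n x :: nat)"
proof -
  have "computable (\<lambda>x. rec_nat 0 (\<lambda>_ k. m x + k) (n x))"
    by (intro computable_rec_nat assms)
      (auto simp add: split_def intro!: computable_basic computable_plus computable_compose[OF assms(1)])
  moreover have "rec_nat 0 (\<lambda>_ k. a + k) b = a * b" for a b :: nat
    by (induction b) auto
  ultimately show ?thesis by simp
qed

lemma computable_le:
  assumes "computable m" "computable n"
  shows "computable (\<lambda>x. m x \<le> (n x :: nat))"
  using computable_eq_0[OF computable_minus[OF assms]] by simp

text \<open>On natural numbers \<open>enc\<close> is the identity, so the machine that computes the
  code of \<open>f x\<close> also computes \<open>f\<close>. For other types this leaves only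
  arithmetic on codes.\<close>

lemma computable_of_enc:
  assumes "computable (\<lambda>x. enc (f x))"
  shows "computable f"
  using assms by (simp add: computable_def computes_def enc_nat_def)

lemma computable_enc: "computable f \<Longrightarrow> computable (\<lambda>x. enc (f x))"
  by (simp add: computable_def computes_def enc_nat_def)

lemma computable_eq:
  assumes "computable f" "computable g"
  shows "computable (\<lambda>x. f x = g x)"
proof -
  have "computable (\<lambda>x. enc (f x) \<le> enc (g x) \<and> enc (g x) \<le> enc (f x))"
    by (intro computable_conj computable_le computable_enc assms)
  moreover have "(enc (f x) \<le> enc (g x) \<and> enc (g x) \<le> enc (f x)) \<longleftrightarrow> f x = g x" for x
    by (metis enc_inject order_antisym order_refl)
  ultimately show ?thesis by simp
qed

text \<open>One recursion counts with carry: whenever the remainder would reach \<open>d\<close>, it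
  is reset and the quotient grows by 1.\<close>

lemma computable_divmod:
  assumes "computable n" "d > (0 :: nat)"
  shows "computable (\<lambda>x. (n x div d, n x mod d))"
proof -
  have "computable (\<lambda>x. rec_nat (0, 0)
      (\<lambda>_ r. if Suc (snd r) = d then (Suc (fst r), 0) else (fst r, Suc (snd r))) (n x))"
    by (intro computable_rec_nat assms)
      (auto simp add: split_def intro!: computable_basic computable_eq)
  moreover have "rec_nat (0, 0)
      (\<lambda>_ r. if Suc (snd r) = d then (Suc (fst r), 0) else (fst r, Suc (snd r))) k
      = (k div d, k mod d)" for k
    using assms(2) by (induction k) (auto simp: div_Suc mod_Suc)
  ultimately show ?thesis by simp
qed

lemma computable_div: "computable n \<Longrightarrow> d > 0 \<Longrightarrow> computable (\<lambda>x. n x div d :: nat)"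
  using computable_fst[OF computable_divmod] by force

lemma computable_mod: "computable n \<Longrightarrow> d > 0 \<Longrightarrow> computable (\<lambda>x. n x mod d :: nat)"
  using computable_snd[OF computable_divmod] by force

section \<open>Arithmetic of integers\<close>

lemma computable_int:
  assumes "computable n"
  shows "computable (\<lambda>x. int (n x))"
proof (rule computable_of_enc)
  show "computable (\<lambda>x. enc (int (n x)))"
    unfolding enc_int_def by (simp add: computable_times computable_const assms)
qed

lemma computable_uminus_int:
  assumes "computable n"
  shows "computable (\<lambda>x. - int (n x))"
proof (rule computable_of_enc)
  \<comment> \<open>For \<open>k = 0\<close> truncated subtraction gives 0, which is the code of
    zero, so one formula covers all cases.\<close>
  have "enc (- int k) = 2 * k - 1" for k
    unfolding enc_int_def by simp
  then show "computable (\<lambda>x. enc (- int (n x)))"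
    using computable_pred[OF computable_times[OF computable_const[of 2] assms]] by simp
qed

lemma computable_nat:
  assumes "computable i"
  shows "computable (\<lambda>x. nat (i x))"
proof -
  have "computable (\<lambda>x. if enc (i x) mod 2 = 0 then enc (i x) div 2 else 0)"
    by (intro computable_basic computable_mod computable_div computable_enc assms) auto
  moreover have "(if enc k mod 2 = 0 then enc k div 2 else 0) = nat k" for k :: int
    by (cases k rule: int_cases) (auto simp: enc_int_def)
  ultimately show ?thesis by simp
qed

lemma computable_nat_uminus:
  assumes "computable i"
  shows "computable (\<lambda>x. nat (- i x))"
proof -
  have "computable (\<lambda>x. if enc (i x) mod 2 = 0 then 0 else Suc (enc (i x)) div 2)"
    by (intro computable_basic computable_mod computable_div computable_enc assms) auto
  moreover have "(if enc k mod 2 = 0 then 0 else Suc (enc k) div 2) = nat (- k)" for k :: int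
    by (cases k rule: int_cases) (auto simp: enc_int_def nat_add_distrib)
  ultimately show ?thesis by simp
qed

lemma computable_int_diff:
  assumes "computable m" "computable n"
  shows "computable (\<lambda>x. int (m x) - int (n x))"
proof -
  have "computable (\<lambda>x. if n x \<le> m x then int (m x - n x) else - int (n x - m x))"
    by (intro computable_If computable_le computable_int computable_uminus_int computable_minus assms)
  moreover have "(if b \<le> a then int (a - b) else - int (b - a)) = int a - int b" for a b
    by auto
  ultimately show ?thesis by simp
qed

text \<open>An integer is the difference of \<open>nat i\<close> and \<open>nat (- i)\<close>, which
  reduces the sum to operations on natural numbers.\<close>

lemma computable_plus_int:
  assumes "computable i" "computable j"
  shows "computable (\<lambda>x. i x + j x :: int)"
proof -
  have "computable (\<lambda>x. int (nat (i x) + nat (j x)) - int (nat (- i x) + nat (- j x)))"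
    by (intro computable_int_diff computable_plus computable_nat computable_nat_uminus assms)
  moreover have "int (nat a + nat b) - int (nat (- a) + nat (- b)) = a + b" for a b
    by auto
  ultimately show ?thesis by simp
qed

lemma computable_times_nat_int:
  assumes "computable i"
  shows "computable (\<lambda>x. int d * i x)"
  by (induction d) (auto simp: algebra_simps intro!: computable_const computable_plus_int assms)

lemma computable_div_int:
  assumes i: "computable i" and d: "d > 0"
  shows "computable (\<lambda>x. i x div int d)"
proof -
  \<comment> \<open>At most one of the two terms is nonzero. For a negative dividend
    \<open>- m\<close> the floor of the quotient is minus the ceiling of \<open>m / d\<close>, and
    adding \<open>d - 1\<close> before dividing turns floor into ceiling.\<close>
  have "computable (\<lambda>x. int (nat (i x) div d) - int ((nat (- i x) + (d - 1)) div d))"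
    by (intro computable_int_diff computable_div computable_plus computable_nat
        computable_nat_uminus computable_const assms)
  moreover have "int (nat k div d) - int ((nat (- k) + (d - 1)) div d) = k div int d" for k
  proof (cases "k \<ge> 0")
    case True
    with d show ?thesis by (simp add: zdiv_int)
  next
    case False
    define m where "m = nat (- k)"
    have k: "k = - int m" using False by (simp add: m_def)
    have "int ((m + (d - 1)) div d) = - ((- int m) div int d)"
    proof -
      define q r where "q = int m div int d" and "r = int m mod int d"
      have m: "int m = q * int d + r" and r: "0 \<le> r" "r < int d"
        using d by (simp_all add: q_def r_def)
      have "int ((m + (d - 1)) div d) = (int m + int d - 1) div int d"
        using d by (simp add: zdiv_int of_nat_diff algebra_simps)
      also have "\<dots> = (if r = 0 then q else q + 1)"
      proof (cases "r = 0")
        case True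
        then have "int m + int d - 1 = (int d - 1) + q * int d" by (simp add: m)
        moreover have "(int d - 1) div int d = 0" using d by simp
        ultimately show ?thesis
          using d div_mult_self1[of "int d" "int d - 1" q] by (simp only: True) simp
      next
        case False
        have "int m + int d - 1 = (r - 1) + (q + 1) * int d" by (simp add: m algebra_simps)
        moreover have "(r - 1) div int d = 0" using r False by simp
        moreover have "((r - 1) + (q + 1) * int d) div int d = (q + 1) + (r - 1) div int d"
          using d by (intro div_mult_self1) simp
        ultimately show ?thesis using False by (simp only: if_False)
      qed
      also have "\<dots> = - ((- int m) div int d)"
        using d by (simp add: zdiv_zminus1_eq_if q_def r_def)
      finally show ?thesis .
    qed
    then show ?thesis by (simp add: k)
  qed
  ultimately show ?thesis by simp
qed

lemma computable_minus_int:
  assumes "computable i" "computable j"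
  shows "computable (\<lambda>x. i x - j x :: int)"
proof -
  have "computable (\<lambda>x. int (nat (i x) + nat (- j x)) - int (nat (- i x) + nat (j x)))"
    by (intro computable_int_diff computable_plus computable_nat computable_nat_uminus assms)
  moreover have "int (nat a + nat (- b)) - int (nat (- a) + nat b) = a - b" for a b
    by auto
  ultimately show ?thesis by simp
qed

lemma computable_mod_int:
  assumes "computable i" "d > 0"
  shows "computable (\<lambda>x. i x mod int d)"
proof -
  have "computable (\<lambda>x. i x - int d * (i x div int d))"
    by (intro computable_minus_int computable_times_nat_int computable_div_int assms)
  then show ?thesis by (simp add: minus_mult_div_eq_mod)
qed

section \<open>Operations on lists\<close>

lemma computable_Cons:
  assumes "computable f" "computable g"
  shows "computable (\<lambda>x. f x # g x)"
proof -
  have "computable (\<lambda>x. Suc (enc (f x, g x)))"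
    by (intro computable_basic computable_enc assms)
  then show ?thesis
    by (auto intro: computable_of_enc simp: enc_Cons enc_Pair)
qed

lemma computable_tl:
  fixes l :: "'a::encodable \<Rightarrow> 'b::encodable list"
  assumes "computable l"
  shows "computable (\<lambda>x. tl (l x))"
proof (rule computable_of_enc)
  have "computable (\<lambda>x. snd (prod_decode (enc (l x) - 1)))"
  proof -
    have "computable (\<lambda>n. snd (prod_decode n))"
      by (rule computableI[of Proj2]) (simp add: enc_nat_def)
    from computable_compose[OF this computable_pred[OF computable_enc[OF assms]]]
    show ?thesis .
  qed
  moreover have "snd (prod_decode (enc xs - 1)) = enc (tl xs)" for xs :: "'b list"
  proof (cases xs)
    case Nil
    have "prod_decode 0 = (0, 0)" by (simp add: prod_decode_def prod_decode_aux.simps)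
    then show ?thesis by (simp add: Nil enc_Nil)
  qed (simp add: enc_Cons)
  ultimately show "computable (\<lambda>x. enc (tl (l x)))" by simp
qed

text \<open>The default is there because \<^term>\<open>hd []\<close> is unspecified.\<close>

lemma computable_hd:
  fixes l :: "'a::encodable \<Rightarrow> 'b::encodable list"
  assumes "computable l" "computable d"
  shows "computable (\<lambda>x. if l x = [] then d x else hd (l x))"
proof (rule computable_of_enc)
  have "computable (\<lambda>x. if enc (l x) = 0 then enc (d x) else fst (prod_decode (enc (l x) - 1)))"
  proof -
    have "computable (\<lambda>n. fst (prod_decode n))"
      by (rule computableI[of Proj1]) (simp add: enc_nat_def)
    from computable_compose[OF this computable_pred[OF computable_enc[OF assms(1)]]]
    show ?thesis
      by (intro computable_If computable_eq_0 computable_enc assms)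
  qed
  moreover have "(if enc xs = 0 then enc y else fst (prod_decode (enc xs - 1)))
      = enc (if xs = [] then y else hd xs)" for xs :: "'b list" and y
    by (cases xs) (auto simp: enc_Nil enc_Cons)
  ultimately show "computable (\<lambda>x. enc (if l x = [] then d x else hd (l x)))" by simp
qed

text \<open>The recursion carries the accumulator and the unread rest of the list. A step changes
  nothing once the rest is empty, so any number of rounds not below the length will do, in
  particular the code of the list.\<close>

lemma computable_foldl:
  fixes l :: "'a::encodable \<Rightarrow> 'b::encodable list" and a :: "'a \<Rightarrow> 'c::encodable"
  assumes g: "computable (\<lambda>(x, r, y). g x r y)" and a: "computable a" and l: "computable l"
  shows "computable (\<lambda>x. foldl (g x) (a x) (l x))"
proof -
  define d :: 'b where "d = undefined"
  define step where "step x z =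
    (if snd z = [] then z
     else (g x (fst z) (if snd z = [] then d else hd (snd z)), tl (snd z)))" for x and z :: "'c \<times> 'b list"
  have step: "computable (\<lambda>(x, k :: nat, z). step x z)"
  proof -
    have "computable (\<lambda>z :: 'a \<times> nat \<times> 'c \<times> 'b list. (\<lambda>(x, r, y). g x r y)
       (fst z, fst (snd (snd z)), if snd (snd (snd z)) = [] then d else hd (snd (snd (snd z)))))"
      by (intro computable_compose[OF g] computable_Pair computable_hd computable_basic)
    then show ?thesis
      unfolding step_def split_def
      by (intro computable_basic computable_tl computable_eq) (simp_all add: split_def)
  qed
  have *: "computable (\<lambda>x. fst (rec_nat (a x, l x) (\<lambda>_. step x) (enc (l x))))"
    by (intro computable_basic computable_rec_nat a l computable_enc step)
  have "rec_nat (r, xs) (\<lambda>_. step x) n = (foldl (g x) r (take n xs), drop n xs)"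
    for r xs n x
  proof (induction n)
    case (Suc n)
    show ?case
    proof (cases "drop n xs")
      case Nil
      then show ?thesis using Suc by (simp add: step_def)
    next
      case (Cons y ys)
      then have n: "n < length xs" by (metis drop_eq_Nil leI list.distinct(1))
      with Cons have "y = xs ! n" "ys = drop (Suc n) xs"
        by (simp_all add: Cons_nth_drop_Suc[symmetric])
      then show ?thesis using Suc Cons n by (simp add: step_def take_Suc_conv_app_nth)
    qed
  qed simp
  then have "fst (rec_nat (a x, l x) (\<lambda>_. step x) (enc (l x))) = foldl (g x) (a x) (l x)" for x
    using length_le_enc[of "l x"] by simp
  with * show ?thesis by simp
qed

lemma computable_rev:
  assumes "computable l"
  shows "computable (\<lambda>x. rev (l x))"
proof -
  have "computable (\<lambda>x. foldl (\<lambda>r y. y # r) [] (l x))"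
    by (intro computable_foldl assms)
      (auto simp: split_def intro!: computable_basic computable_Cons)
  moreover have "foldl (\<lambda>r y. y # r) ys xs = rev xs @ ys" for xs ys :: "'b list"
    by (induction xs arbitrary: ys) auto
  ultimately show ?thesis by simp
qed

lemma computable_foldr:
  fixes l :: "'a::encodable \<Rightarrow> 'b::encodable list" and a :: "'a \<Rightarrow> 'c::encodable"
  assumes g: "computable (\<lambda>(x, y, r). g x y r)" and a: "computable a" and l: "computable l"
  shows "computable (\<lambda>x. foldr (g x) (l x) (a x))"
proof -
  have "computable (\<lambda>z :: 'a \<times> 'c \<times> 'b. (\<lambda>(x, y, r). g x y r) (fst z, snd (snd z), fst (snd z)))"
    by (intro computable_compose[OF g] computable_basic)
  then have "computable (\<lambda>x. foldl (\<lambda>r y. g x y r) (a x) (rev (l x)))"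
    by (intro computable_foldl computable_rev a l) (simp add: split_def)
  then show ?thesis by (simp add: foldr_conv_foldl)
qed

lemma computable_append:
  assumes "computable k" "computable l"
  shows "computable (\<lambda>x. k x @ l x)"
proof -
  have "computable (\<lambda>x. foldr (\<lambda>y r. y # r) (k x) (l x))"
    by (intro computable_foldr assms)
      (auto simp: split_def intro!: computable_basic computable_Cons)
  moreover have "foldr (\<lambda>y r. y # r) xs ys = xs @ ys" for xs ys :: "'b list"
    by (induction xs) auto
  ultimately show ?thesis by simp
qed

lemma computable_map:
  fixes l :: "'a::encodable \<Rightarrow> 'b::encodable list" and g :: "'a \<Rightarrow> 'b \<Rightarrow> 'c::encodable"
  assumes g: "computable (\<lambda>(x, y). g x y)" and l: "computable l"
  shows "computable (\<lambda>x. map (g x) (l x))"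
proof -
  have "computable (\<lambda>z :: 'a \<times> 'b \<times> 'c list. (\<lambda>(x, y). g x y) (fst z, fst (snd z)))"
    by (intro computable_compose[OF g] computable_basic)
  then have "computable (\<lambda>x. foldr (\<lambda>y r. g x y # r) (l x) [])"
    by (intro computable_foldr l computable_const)
      (auto simp: split_def intro!: computable_basic computable_Cons)
  moreover have "foldr (\<lambda>y r. g x y # r) xs [] = map (g x) xs" for xs x
    by (induction xs) auto
  ultimately show ?thesis by simp
qed

lemma computable_concat:
  assumes "computable l"
  shows "computable (\<lambda>x. concat (l x))"
proof -
  have "computable (\<lambda>x. foldr (\<lambda>y r. y @ r) (l x) [])"
    by (intro computable_foldr assms computable_const)
      (auto simp: split_def intro!: computable_basic computable_append)
  moreover have "foldr (\<lambda>y r. y @ r) xs [] = concat xs" for xs :: "'b list list"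
    by (induction xs) auto
  ultimately show ?thesis by simp
qed

lemma computable_list_decode: "computable list_decode"
proof (rule computable_of_enc)
  have "enc (list_decode n) = n" for n
    by (simp add: enc_list_def enc_nat_def cong: map_cong)
  then show "computable (\<lambda>n. enc (list_decode n))" by (simp add: computable_id)
qed

lemma computable_prod_decode: "computable prod_decode"
proof (rule computable_of_enc)
  show "computable (\<lambda>n. enc (prod_decode n))" by (simp add: enc_prod_def enc_nat_def computable_id)
qed

lemma computable_prod_encode: "computable prod_encode"
proof (rule computable_of_enc)
  have "enc (prod_encode z) = enc z" for z by (simp add: enc_prod_def enc_nat_def)
  then show "computable (\<lambda>n. enc (prod_encode n))" by (simp add: computable_enc computable_id)
qed

section \<open>Presented groups\<close>

lemma Nil_in_words [simp]: "[] \<in> words X"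
  by (simp add: words_def)

lemma Cons_in_words [simp]: "a # w \<in> words X \<longleftrightarrow> fst a \<in> X \<and> w \<in> words X"
  by (cases a) (auto simp: words_def)

lemma append_in_words [simp]: "u @ v \<in> words X \<longleftrightarrow> u \<in> words X \<and> v \<in> words X"
  by (induction u) auto

lemma replicate_in_words [simp]: "fst a \<in> X \<Longrightarrow> replicate n a \<in> words X"
  by (induction n) auto

lemma inv_letter_inv_letter [simp]: "inv_letter (inv_letter a) = a"
  by (simp add: inv_letter_def)

lemma fst_inv_letter [simp]: "fst (inv_letter a) = fst a"
  by (simp add: inv_letter_def)

lemma inv_word_Nil [simp]: "inv_word [] = []"
  by (simp add: inv_word_def)

lemma inv_word_Cons [simp]: "inv_word (a # w) = inv_word w @ [inv_letter a]"
  by (simp add: inv_word_def)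

lemma inv_word_append [simp]: "inv_word (u @ v) = inv_word v @ inv_word u"
  by (simp add: inv_word_def)

lemma inv_word_inv_word [simp]: "inv_word (inv_word w) = w"
  by (induction w) auto

lemma inv_word_in_words [simp]: "inv_word w \<in> words X \<longleftrightarrow> w \<in> words X"
  by (induction w) auto

lemma subst_Nil [simp]: "subst f [] = []"
  by (simp add: subst_def)

lemma subst_Cons:
  "subst f (a # w) = (if snd a then f (fst a) else inv_word (f (fst a))) @ subst f w"
  by (simp add: subst_def split_def)

lemma subst_append [simp]: "subst f (u @ v) = subst f u @ subst f v"
  by (simp add: subst_def)

lemma subst_inv_letter: "subst f [inv_letter a] = inv_word (subst f [a])"
  by (simp add: subst_Cons inv_letter_def)

lemma subst_in_words:
  "(\<And>x. x \<in> X \<Longrightarrow> f x \<in> words Y) \<Longrightarrow> w \<in> words X \<Longrightarrow> subst f w \<in> words Y"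
  by (induction w) (auto simp: subst_Cons)

lemma subst_gen_word [simp]: "subst gen_word w = w"
  by (induction w) (auto simp: subst_Cons inv_letter_def)

locale wf_presentation =
  fixes P :: "'a presentation"
  assumes rels_subset: "rels P \<subseteq> words (gens P)"
begin

abbreviation equiv_P (infix "\<approx>" 50) where "u \<approx> v \<equiv> word_equiv P u v"

abbreviation carrier_words where "carrier_words \<equiv> words (gens P)"

lemma equiv_in_words:
  assumes "u \<approx> v"
  shows "u \<in> carrier_words" "v \<in> carrier_words"
  using assms by induction (use rels_subset in auto)

lemma equiv_context:
  assumes "u \<approx> v" "a \<in> carrier_words" "b \<in> carrier_words"
  shows "a @ u @ b \<approx> a @ v @ b"
  using assms(1)
proof induction
  case (refl u)
  then show ?case using assms by (intro word_equiv.refl) auto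
next
  case (sym u v)
  then show ?case by (blast intro: word_equiv.sym)
next
  case (trans u v w)
  then show ?case by (blast intro: word_equiv.trans)
next
  case (trivial u v c)
  then show ?case using assms word_equiv.trivial[of "a @ u" "v @ b" P c] by simp
next
  case (relator u v r)
  then show ?case using assms word_equiv.relator[of "a @ u" "v @ b" P r] by simp
qed

lemma equiv_append:
  assumes "u \<approx> u'" "v \<approx> v'"
  shows "u @ v \<approx> u' @ v'"
proof -
  have "u @ v \<approx> u' @ v"
    using equiv_context[OF assms(1), of "[]" v] equiv_in_words[OF assms(2)] by simp
  moreover have "u' @ v \<approx> u' @ v'"
    using equiv_context[OF assms(2), of u' "[]"] equiv_in_words[OF assms(1)] by simp
  ultimately show ?thesis by (rule word_equiv.trans)
qed

lemma equiv_inv_right: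
  assumes "w \<in> carrier_words"
  shows "w @ inv_word w \<approx> []"
  using assms
proof (induction w)
  case Nil
  show ?case by (simp add: word_equiv.refl)
next
  case (Cons a w)
  then have "[a] @ (w @ inv_word w) @ [inv_letter a] \<approx> [a] @ [] @ [inv_letter a]"
    by (intro equiv_context) auto
  moreover have "[a, inv_letter a] \<approx> []"
    using word_equiv.trivial[of "[]" "[]" P a] Cons.prems by simp
  ultimately show ?case by simp (rule word_equiv.trans)
qed

lemma equiv_inv_left: "w \<in> carrier_words \<Longrightarrow> inv_word w @ w \<approx> []"
  using equiv_inv_right[of "inv_word w"] by simp

text \<open>Only \<open>u\<close> is required to be a word on the generators: any other string has
  an empty class, whereas the class of \<open>u\<close> contains \<open>u\<close>.\<close>

lemma class_eq_iff:
  "u \<in> carrier_words \<Longrightarrow> word_class P u = word_class P v \<longleftrightarrow> u \<approx> v"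
  unfolding word_class_def set_eq_iff mem_Collect_eq
  by (metis word_equiv.refl word_equiv.sym word_equiv.trans)

lemma class_mult:
  assumes "u \<in> carrier_words" "v \<in> carrier_words"
  shows "word_class P u \<otimes>\<^bsub>presented_group P\<^esub> word_class P v = word_class P (u @ v)"
proof -
  have "word_class P (u' @ v') = word_class P (u @ v)"
    if "u' \<in> word_class P u" "v' \<in> word_class P v" for u' v'
    using equiv_append[of u u' v v'] that assms class_eq_iff[of "u @ v" "u' @ v'"]
    by (simp add: word_class_def)
  moreover have "u \<in> word_class P u" "v \<in> word_class P v"
    using assms by (simp_all add: word_class_def word_equiv.refl)
  ultimately have "(\<Union>u'\<in>word_class P u. \<Union>v'\<in>word_class P v. word_class P (u' @ v'))
      = word_class P (u @ v)"
    by blast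
  then show ?thesis by (simp add: presented_group_def)
qed

lemma class_in_carrier: "w \<in> carrier_words \<Longrightarrow> word_class P w \<in> carrier (presented_group P)"
  by (simp add: presented_group_def)

lemma in_carrierE:
  assumes "A \<in> carrier (presented_group P)"
  obtains w where "w \<in> carrier_words" "A = word_class P w"
  using assms by (auto simp: presented_group_def)

lemma one_presented_group: "\<one>\<^bsub>presented_group P\<^esub> = word_class P []"
  by (simp add: presented_group_def)

lemma group_presented_group: "group (presented_group P)"
proof (rule groupI)
  fix A assume "A \<in> carrier (presented_group P)"
  then obtain w where w: "w \<in> carrier_words" "A = word_class P w" by (rule in_carrierE)
  have "word_class P (inv_word w) \<otimes>\<^bsub>presented_group P\<^esub> A = \<one>\<^bsub>presented_group P\<^esub>"
    using w by (simp add: class_mult one_presented_group class_eq_iff equiv_inv_left)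
  then show "\<exists>B\<in>carrier (presented_group P). B \<otimes>\<^bsub>presented_group P\<^esub> A = \<one>\<^bsub>presented_group P\<^esub>"
    using class_in_carrier[of "inv_word w"] w by auto
qed (auto elim!: in_carrierE simp: class_mult one_presented_group class_in_carrier)

lemma class_inv_word:
  assumes "w \<in> carrier_words"
  shows "word_class P (inv_word w) = inv\<^bsub>presented_group P\<^esub> word_class P w"
proof -
  interpret group "presented_group P" by (rule group_presented_group)
  show ?thesis
    using assms
    by (intro inv_equality[symmetric])
      (simp_all add: class_mult one_presented_group class_eq_iff equiv_inv_left class_in_carrier)
qed

end

text \<open>The principle of von Dyck at the level of words: a substitution that kills the relators
  induces a homomorphism.\<close>

lemma subst_equiv:
  assumes Q: "rels Q \<subseteq> words (gens Q)"
    and f: "\<And>x. x \<in> gens P \<Longrightarrow> f x \<in> words (gens Q)"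
    and rel: "\<And>r. r \<in> rels P \<Longrightarrow> word_equiv Q (subst f r) []"
    and "word_equiv P u v"
  shows "word_equiv Q (subst f u) (subst f v)"
  using assms(4)
proof induction
  interpret Q: wf_presentation Q by standard (rule Q)
  case (trivial u v a)
  have w: "subst f w \<in> words (gens Q)" if "w \<in> words (gens P)" for w
    using f that by (rule subst_in_words)
  have "word_equiv Q (subst f [a] @ inv_word (subst f [a])) []"
    using trivial by (intro Q.equiv_inv_right w) auto
  then have "word_equiv Q (subst f u @ (subst f [a] @ inv_word (subst f [a])) @ subst f v)
      (subst f u @ [] @ subst f v)"
    using trivial by (intro Q.equiv_context w) auto
  then show ?case
    by (metis append_Cons append_Nil append_assoc subst_append subst_inv_letter)
next
  interpret Q: wf_presentation Q by standard (rule Q)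
  case (relator u v r)
  have "word_equiv Q (subst f u @ subst f r @ subst f v) (subst f u @ [] @ subst f v)"
    using relator f by (intro Q.equiv_context rel) (auto intro: subst_in_words)
  then show ?case by simp
next
  case (refl u)
  then show ?case using f by (auto intro: word_equiv.refl subst_in_words)
qed (blast intro: word_equiv.sym word_equiv.trans)+

lemma subst_subst_equiv:
  assumes P: "rels P \<subseteq> words (gens P)"
    and fg: "\<And>x. x \<in> gens P \<Longrightarrow> word_equiv P (subst g (f x)) (gen_word x)"
    and "w \<in> words (gens P)"
  shows "word_equiv P (subst g (subst f w)) w"
  using assms(3)
proof (induction w)
  interpret wf_presentation P by standard (rule P)
  case Nil
  show ?case by (simp add: word_equiv.refl)
next
  interpret wf_presentation P by standard (rule P)
  case (Cons a w)
  have inv: "subst g (inv_word u) = inv_word (subst g u)" for u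
    by (induction u) (simp_all add: subst_inv_letter subst_Cons[of g])
  have eq: "inv_word u \<approx> inv_word v" if "u \<approx> v" for u v
    using that equiv_in_words[OF that] group_presented_group
    by (metis class_eq_iff class_inv_word inv_word_in_words)
  have "subst g (subst f [a]) \<approx> [a]"
    using fg[of "fst a"] eq[OF fg[of "fst a"]] Cons.prems
    by (cases a) (auto simp: subst_Cons inv inv_letter_def)
  with Cons show ?case
    using equiv_append[of "subst g (subst f [a])" "[a]" "subst g (subst f w)" w]
    by (simp add: subst_Cons[of f])
qed

lemma presented_group_iso:
  assumes P: "rels P \<subseteq> words (gens P)" and Q: "rels Q \<subseteq> words (gens Q)"
    and f: "\<And>x. x \<in> gens P \<Longrightarrow> f x \<in> words (gens Q)"
    and g: "\<And>y. y \<in> gens Q \<Longrightarrow> g y \<in> words (gens P)"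
    and f_rel: "\<And>r. r \<in> rels P \<Longrightarrow> word_equiv Q (subst f r) []"
    and g_rel: "\<And>r. r \<in> rels Q \<Longrightarrow> word_equiv P (subst g r) []"
    and gf: "\<And>x. x \<in> gens P \<Longrightarrow> word_equiv P (subst g (f x)) (gen_word x)"
    and fg: "\<And>y. y \<in> gens Q \<Longrightarrow> word_equiv Q (subst f (g y)) (gen_word y)"
  shows "presented_group P \<cong> presented_group Q"
proof -
  interpret P: wf_presentation P by standard (rule P)
  interpret Q: wf_presentation Q by standard (rule Q)
  \<comment> \<open>All representatives of a class have equivalent images, so on a class this union
    is a single class and no representative has to be chosen.\<close>
  define h where "h A = (\<Union>w\<in>A. word_class Q (subst f w))" for A
  have fw: "subst f w \<in> words (gens Q)" if "w \<in> words (gens P)" for w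
    using f that by (rule subst_in_words)
  have gw: "subst g w \<in> words (gens P)" if "w \<in> words (gens Q)" for w
    using g that by (rule subst_in_words)
  have fe: "word_equiv Q (subst f u) (subst f v)" if "word_equiv P u v" for u v
    using Q f f_rel that by (rule subst_equiv)
  have ge: "word_equiv P (subst g u) (subst g v)" if "word_equiv Q u v" for u v
    using P g g_rel that by (rule subst_equiv)
  have gfe: "word_equiv P (subst g (subst f w)) w" if "w \<in> words (gens P)" for w
    using P gf that by (rule subst_subst_equiv)
  have fge: "word_equiv Q (subst f (subst g w)) w" if "w \<in> words (gens Q)" for w
    using Q fg that by (rule subst_subst_equiv)
  have h: "h (word_class P w) = word_class Q (subst f w)" if w: "w \<in> words (gens P)" for w
  proof -
    have "word_class Q (subst f v) = word_class Q (subst f w)" if "v \<in> word_class P w" for v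
      using fe[of w v] that[unfolded word_class_def] Q.class_eq_iff[OF fw[OF w]] by blast
    moreover have "w \<in> word_class P w" using w by (simp add: word_class_def word_equiv.refl)
    ultimately show ?thesis unfolding h_def by blast
  qed
  have "h \<in> iso (presented_group P) (presented_group Q)"
  proof (rule isoI)
    show "h \<in> hom (presented_group P) (presented_group Q)"
    proof (rule homI)
      fix A B assume "A \<in> carrier (presented_group P)" "B \<in> carrier (presented_group P)"
      then show "h (A \<otimes>\<^bsub>presented_group P\<^esub> B) = h A \<otimes>\<^bsub>presented_group Q\<^esub> h B"
        by (auto elim!: P.in_carrierE simp: P.class_mult Q.class_mult h fw)
    qed (auto elim!: P.in_carrierE simp: h fw Q.class_in_carrier)
    have "inj_on h (carrier (presented_group P))"
    proof (rule inj_onI)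
      fix A B assume AB: "A \<in> carrier (presented_group P)" "B \<in> carrier (presented_group P)" "h A = h B"
      then obtain u v where u: "u \<in> words (gens P)" "A = word_class P u"
        and v: "v \<in> words (gens P)" "B = word_class P v"
        by (metis P.in_carrierE)
      then have "word_equiv Q (subst f u) (subst f v)"
        using AB(3) Q.class_eq_iff[OF fw[OF u(1)]] by (simp add: h)
      from ge[OF this] have "word_equiv P u v"
        using gfe[OF u(1)] gfe[OF v(1)] by (blast intro: word_equiv.sym word_equiv.trans)
      then show "A = B" using u v P.class_eq_iff by simp
    qed
    moreover have "h ` carrier (presented_group P) = carrier (presented_group Q)"
    proof (intro equalityI subsetI)
      fix B assume "B \<in> carrier (presented_group Q)"
      then obtain v where v: "v \<in> words (gens Q)" "B = word_class Q v" by (rule Q.in_carrierE)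
      have "h (word_class P (subst g v)) = B"
        using fge[OF v(1)] v by (simp add: h gw fw Q.class_eq_iff)
      then show "B \<in> h ` carrier (presented_group P)"
        using P.class_in_carrier[OF gw[OF v(1)]] by blast
    qed (auto elim!: P.in_carrierE simp: h fw Q.class_in_carrier)
    ultimately show "bij_betw h (carrier (presented_group P)) (carrier (presented_group Q))"
      by (simp add: bij_betw_def)
  qed
  then show ?thesis by (auto simp: is_iso_def)
qed

text \<open>A homomorphism is determined by its values on generators; this turns
  \<open>extends_to_iso\<close> into a statement about all words.\<close>

lemma iso_class_subst:
  assumes P: "rels P \<subseteq> words (gens P)" and Q: "rels Q \<subseteq> words (gens Q)"
    and h: "h \<in> iso (presented_group P) (presented_group Q)"
    and hf: "\<And>x. x \<in> gens P \<Longrightarrow> h (word_class P (gen_word x)) = word_class Q (f x)"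
    and w: "w \<in> words (gens P)"
  shows "subst f w \<in> words (gens Q)" "h (word_class P w) = word_class Q (subst f w)"
proof -
  interpret P: wf_presentation P by standard (rule P)
  interpret Q: wf_presentation Q by standard (rule Q)
  interpret GP: group "presented_group P" by (rule P.group_presented_group)
  interpret GQ: group "presented_group Q" by (rule Q.group_presented_group)
  have hom: "h \<in> hom (presented_group P) (presented_group Q)"
    using h by (simp add: iso_def)
  interpret gh: group_hom "presented_group P" "presented_group Q" h
    by unfold_locales (rule hom)
  \<comment> \<open>A string that is not a word on the generators of \<open>Q\<close> has an empty
    class, which is not an element of the group.\<close>
  have f: "f x \<in> words (gens Q)" if "x \<in> gens P" for x
  proof -
    have "word_class Q (f x) \<in> carrier (presented_group Q)"
      using hf[OF that] that gh.hom_closed[OF P.class_in_carrier[of "gen_word x"]] by simp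
    then obtain v where v: "v \<in> words (gens Q)" "word_class Q (f x) = word_class Q v"
      by (rule Q.in_carrierE)
    then show ?thesis
      using Q.class_eq_iff[OF v(1), of "f x"] Q.equiv_in_words(2) by metis
  qed
  show "subst f w \<in> words (gens Q)"
    using f w by (rule subst_in_words)
  show "h (word_class P w) = word_class Q (subst f w)"
    using w
  proof (induction w)
    case Nil
    show ?case using gh.hom_one by (simp add: P.one_presented_group Q.one_presented_group)
  next
    case (Cons a w)
    have a: "h (word_class P [a]) = word_class Q (subst f [a])"
    proof (cases "snd a")
      case True
      then have "[a] = gen_word (fst a)" by (cases a) simp
      then show ?thesis using True Cons.prems hf[of "fst a"] by (simp add: subst_Cons)
    next
      case False
      then have a: "[a] = inv_word (gen_word (fst a))" by (cases a) (simp add: inv_letter_def)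
      have "h (word_class P [a]) = inv\<^bsub>presented_group Q\<^esub> h (word_class P (gen_word (fst a)))"
        unfolding a using Cons.prems
        by (subst P.class_inv_word) (auto intro!: gh.hom_inv P.class_in_carrier)
      then show ?thesis
        using False Cons.prems f[of "fst a"] hf[of "fst a"]
        by (simp add: subst_Cons Q.class_inv_word)
    qed
    have "h (word_class P (a # w)) = h (word_class P [a] \<otimes>\<^bsub>presented_group P\<^esub> word_class P w)"
      using Cons.prems by (simp add: P.class_mult)
    also have "\<dots> = word_class Q (subst f [a]) \<otimes>\<^bsub>presented_group Q\<^esub> word_class Q (subst f w)"
      using Cons by (simp add: P.class_in_carrier a)
    also have "\<dots> = word_class Q (subst f [a] @ subst f w)"
      using Cons.prems f by (intro Q.class_mult subst_in_words[of "gens P"]) auto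
    also have "\<dots> = word_class Q (subst f (a # w))" by (simp add: subst_Cons)
    finally show ?case .
  qed
qed

section \<open>Normal forms in BS(2,3)\<close>

text \<open>The state \<open>([(e\<^sub>k, c\<^sub>k), \<dots>, (e\<^sub>1, c\<^sub>1)], n)\<close> stands for the normal form
  \<open>t\<^sup>c\<^sub>1 s\<^sup>\<plusminus>\<^sup>1 \<dots> t\<^sup>c\<^sub>k s\<^sup>\<plusminus>\<^sup>1 t\<^sup>n\<close> of the HNN extension, with \<open>s\<close> for \<open>e = True\<close>,
  and words act on states by right multiplication. Moving \<open>t\<^sup>2\<close> to the right past \<open>s\<close>,
  or \<open>t\<^sup>3\<close> past \<open>s\<^sup>-\<^sup>1\<close>, brings each \<open>c\<^sub>i\<close> below the index of the associated subgroup.\<close>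

type_synonym state = "(bool \<times> nat) list \<times> int"

definition index :: "bool \<Rightarrow> nat" where
  "index e = (if e then 2 else 3)"

text \<open>Write \<open>n = index e * q + r\<close>. Then \<open>t^n\<close> followed by the stable
  letter equals \<open>t^r\<close>, the stable letter, and \<open>t^(index (\<not> e) * q)\<close>.
  If \<open>r = 0\<close> and the last stable letter is the opposite one, the two cancel and the
  coefficient of the latter joins the exponent.\<close>

definition stable_act :: "bool \<Rightarrow> state \<Rightarrow> state" where
  "stable_act e \<sigma> =
    (let q = snd \<sigma> div int (index e); r = nat (snd \<sigma> mod int (index e)) in
     if r = 0 \<and> fst \<sigma> \<noteq> [] \<and> fst (hd (fst \<sigma>)) \<noteq> e
     then (tl (fst \<sigma>), int (snd (hd (fst \<sigma>))) + int (index (\<not> e)) * q)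
     else ((e, r) # fst \<sigma>, int (index (\<not> e)) * q))"

definition letter_act :: "state \<Rightarrow> nat letter \<Rightarrow> state" where
  "letter_act \<sigma> a =
    (if fst a = 0 then stable_act (snd a) \<sigma> else (fst \<sigma>, snd \<sigma> + (if snd a then 1 else - 1)))"

definition word_act :: "state \<Rightarrow> nat word \<Rightarrow> state" where
  "word_act = foldl letter_act"

definition normal_form :: "nat word \<Rightarrow> state" where
  "normal_form = word_act ([], 0)"

lemma word_act_simps [simp]:
  "word_act \<sigma> [] = \<sigma>"
  "word_act \<sigma> (a # w) = word_act (letter_act \<sigma> a) w"
  "word_act \<sigma> (u @ v) = word_act (word_act \<sigma> u) v"
  by (simp_all add: word_act_def)

text \<open>Besides the bound on coefficients this is Britton's condition: no two opposite stable
  letters have coefficient 0 between them.\<close>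

fun reduced :: "(bool \<times> nat) list \<Rightarrow> bool" where
  "reduced [] = True"
| "reduced ((e, c) # st) \<longleftrightarrow> c < index e \<and> reduced st \<and> (c = 0 \<and> st \<noteq> [] \<longrightarrow> fst (hd st) = e)"

lemma index_pos [simp]: "0 < index e"
  by (simp add: index_def)

lemma reduced_tl: "reduced st \<Longrightarrow> reduced (tl st)"
  by (cases st rule: reduced.cases) auto

lemma reduced_stable_act: "reduced (fst \<sigma>) \<Longrightarrow> reduced (fst (stable_act e \<sigma>))"
  by (auto simp: stable_act_def Let_def reduced_tl nat_less_iff)

lemma reduced_letter_act: "reduced (fst \<sigma>) \<Longrightarrow> reduced (fst (letter_act \<sigma> a))"
  by (simp add: letter_act_def reduced_stable_act)

lemma reduced_word_act: "reduced (fst \<sigma>) \<Longrightarrow> reduced (fst (word_act \<sigma> w))"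
  by (induction w arbitrary: \<sigma>) (simp_all add: reduced_letter_act)

text \<open>Cancelling and appending a stable letter undo each other. After a cancellation the
  remainder found on the way back is the old coefficient, and \<open>reduced\<close> rules out that
  a second cancellation occurs instead.\<close>

lemma stable_act_inverse:
  assumes "reduced (fst \<sigma>)"
  shows "stable_act (\<not> e) (stable_act e \<sigma>) = \<sigma>"
proof -
  obtain st n where \<sigma>: "\<sigma> = (st, n)" by (cases \<sigma>)
  define q r where "q = n div int (index e)" and "r = nat (n mod int (index e))"
  have n: "n = int (index e) * q + int r" by (simp add: q_def r_def)
  show ?thesis
  proof (cases "r = 0 \<and> st \<noteq> [] \<and> fst (hd st) \<noteq> e")
    case True
    then obtain c st' where st: "st = (\<not> e, c) # st'" by (cases st) auto
    have act: "stable_act e \<sigma> = (st', int c + int (index (\<not> e)) * q)"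
      using True by (simp add: stable_act_def Let_def \<sigma> st q_def r_def)
    have "c < index (\<not> e)" and "\<not> (c = 0 \<and> st' \<noteq> [] \<and> fst (hd st') \<noteq> (\<not> e))"
      using assms by (auto simp: \<sigma> st)
    then show ?thesis
      using True n unfolding act \<sigma> st stable_act_def Let_def by auto
  next
    case False
    then have act: "stable_act e \<sigma> = ((e, r) # st, int (index (\<not> e)) * q)"
      by (auto simp: stable_act_def Let_def \<sigma> q_def r_def)
    show ?thesis unfolding act unfolding stable_act_def Let_def by (simp add: \<sigma> n)
  qed
qed

text \<open>The relation \<open>t^2 s = s t^3\<close> and its counterpart for \<open>s^-1\<close>,
  acting on states: adding \<open>index e\<close> raises the quotient by 1 and keeps the
  remainder.\<close>

lemma stable_act_shift:
  "stable_act e (st, n + int (index e)) =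
    (fst (stable_act e (st, n)), snd (stable_act e (st, n)) + int (index (\<not> e)))"
  by (simp add: stable_act_def Let_def algebra_simps)

lemma letter_act_inverse:
  "reduced (fst \<sigma>) \<Longrightarrow> letter_act (letter_act \<sigma> a) (inv_letter a) = \<sigma>"
  by (auto simp: letter_act_def inv_letter_def stable_act_inverse prod_eq_iff)

abbreviation "BS \<equiv> baumslag_solitar 2 3"

definition bs_relator :: "nat word" where
  "bs_relator = [(0, False), (1, True), (1, True), (0, True), (1, False), (1, False), (1, False)]"

lemma gens_BS [simp]: "gens BS = {0, 1}"
  by (simp add: baumslag_solitar_def)

lemma rels_BS [simp]: "rels BS = {bs_relator}"
  by (simp add: baumslag_solitar_def bs_relator_def eval_nat_numeral inv_letter_def)

lemma bs_relator_in_words [simp]: "bs_relator \<in> words {0, Suc 0}"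
  by (simp add: bs_relator_def)

lemma finite_presentation_BS: "finite_presentation BS"
  by (simp add: finite_presentation_def)

interpretation BS: wf_presentation BS
  by standard simp

interpretation GBS: group "presented_group BS"
  by (rule BS.group_presented_group)

text \<open>After \<open>s^-1\<close> the factor \<open>t^2\<close> shifts the exponent by 2; the
  following \<open>s\<close> turns this into a shift by 3, which \<open>t^-3\<close> undoes.\<close>

lemma bs_relator_act: "reduced (fst \<sigma>) \<Longrightarrow> word_act \<sigma> bs_relator = \<sigma>"
  using stable_act_shift[of True "fst (stable_act False \<sigma>)" "snd (stable_act False \<sigma>)"]
    stable_act_inverse[of \<sigma> False]
  by (simp add: bs_relator_def letter_act_def index_def prod_eq_iff add.commute)

text \<open>Every insertion allowed in \<open>word_equiv\<close> acts trivially on reduced states.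
  Hence \<open>normal_form\<close> depends only on the element represented.\<close>

lemma word_equiv_act:
  "word_equiv BS u v \<Longrightarrow> reduced (fst \<sigma>) \<Longrightarrow> word_act \<sigma> u = word_act \<sigma> v"
  by (induction arbitrary: \<sigma> rule: word_equiv.induct)
    (auto simp: letter_act_inverse bs_relator_act reduced_word_act)

text \<open>For the converse, states are evaluated in a group whose elements \<open>s\<close> and
  \<open>t\<close> satisfy the relation, to see that a normal form represents the same element as
  the word it comes from.\<close>

locale bs_pair = group +
  fixes s t
  assumes s_closed [simp]: "s \<in> carrier G" and t_closed [simp]: "t \<in> carrier G"
    and bs_relation: "t [^] (2::int) \<otimes> s = s \<otimes> t [^] (3::int)"
begin

definition stable :: "bool \<Rightarrow> 'a" where
  "stable e = (if e then s else inv s)"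

definition letter :: "nat letter \<Rightarrow> 'a" where
  "letter a = (if fst a = 0 then stable (snd a) else if snd a then t else inv t)"

fun prefix_elt :: "(bool \<times> nat) list \<Rightarrow> 'a" where
  "prefix_elt [] = \<one>"
| "prefix_elt ((e, c) # st) = prefix_elt st \<otimes> (t [^] int c \<otimes> stable e)"

definition state_elt :: "state \<Rightarrow> 'a" where
  "state_elt \<sigma> = prefix_elt (fst \<sigma>) \<otimes> t [^] snd \<sigma>"

lemma stable_closed [simp]: "stable e \<in> carrier G"
  by (simp add: stable_def)

lemma prefix_elt_closed [simp]: "prefix_elt st \<in> carrier G"
  by (induction st rule: prefix_elt.induct) simp_all

text \<open>Conjugation by \<open>x\<close> takes \<open>a\<close> to \<open>b\<close>; being an
  endomorphism, it takes powers to powers.\<close>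

lemma int_pow_commute:
  assumes "a \<in> carrier G" "b \<in> carrier G" "x \<in> carrier G" and ab: "a \<otimes> x = x \<otimes> b"
  shows "a [^] (k::int) \<otimes> x = x \<otimes> b [^] k"
proof -
  have cancel: "x \<otimes> (inv x \<otimes> z) = z" if "z \<in> carrier G" for z
    using assms that by (simp add: m_assoc[symmetric])
  interpret h: group_hom G G "\<lambda>y. inv x \<otimes> y \<otimes> x"
    by unfold_locales (use assms in \<open>auto simp: hom_def m_assoc cancel\<close>)
  have "b = inv x \<otimes> a \<otimes> x"
    using assms by (simp add: inv_solve_left m_assoc)
  then have "b [^] k = inv x \<otimes> a [^] k \<otimes> x"
    using h.hom_int_pow[of a k] assms by simp
  then show ?thesis using assms by (simp add: m_assoc cancel)
qed

lemma pow_stable: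
  "t [^] (int (index e) * k) \<otimes> stable e = stable e \<otimes> t [^] (int (index (\<not> e)) * k)"
proof -
  have "t [^] (2 * k) \<otimes> s = s \<otimes> t [^] (3 * k)"
    using int_pow_commute[OF _ _ _ bs_relation, of k] by (simp add: int_pow_pow)
  moreover from this have "t [^] (3 * k) \<otimes> inv s = inv s \<otimes> t [^] (2 * k)"
    by (metis int_pow_closed inv_closed inv_solve_left inv_solve_right m_assoc m_closed s_closed t_closed)
  ultimately show ?thesis by (simp add: stable_def index_def)
qed

lemma stable_not: "stable (\<not> e) \<otimes> stable e = \<one>"
  by (simp add: stable_def)

text \<open>\<open>pow_stable\<close> moves \<open>t^(index e * q)\<close> past the stable letter;
  where a cancellation occurs, the two stable letters are mutually inverse.\<close>

lemma state_elt_stable_act: "state_elt (stable_act e \<sigma>) = state_elt \<sigma> \<otimes> stable e"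
proof -
  obtain st n where \<sigma>: "\<sigma> = (st, n)" by (cases \<sigma>)
  define q r where "q = n div int (index e)" and "r = nat (n mod int (index e))"
  have n: "n = int r + int (index e) * q" by (simp add: q_def r_def)
  have push: "t [^] n \<otimes> stable e = t [^] int r \<otimes> stable e \<otimes> t [^] (int (index (\<not> e)) * q)"
    unfolding n by (simp add: int_pow_mult m_assoc pow_stable)
  show ?thesis
  proof (cases "r = 0 \<and> st \<noteq> [] \<and> fst (hd st) \<noteq> e")
    case True
    then obtain c st' where st: "st = (\<not> e, c) # st'" by (cases st) auto
    have act: "stable_act e \<sigma> = (st', int c + int (index (\<not> e)) * q)"
      using True by (simp add: stable_act_def Let_def \<sigma> st q_def r_def)
    have "state_elt \<sigma> \<otimes> stable e
        = prefix_elt st' \<otimes> t [^] int c \<otimes> stable (\<not> e) \<otimes> (t [^] n \<otimes> stable e)"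
      by (simp add: state_elt_def \<sigma> st m_assoc)
    also have "\<dots> = prefix_elt st' \<otimes> t [^] int c \<otimes> (stable (\<not> e) \<otimes> stable e)
        \<otimes> t [^] (int (index (\<not> e)) * q)"
      using True by (simp add: push m_assoc)
    also have "\<dots> = state_elt (stable_act e \<sigma>)"
      by (simp add: stable_not act state_elt_def int_pow_mult m_assoc)
    finally show ?thesis ..
  next
    case False
    then have act: "stable_act e \<sigma> = ((e, r) # st, int (index (\<not> e)) * q)"
      by (auto simp: stable_act_def Let_def \<sigma> q_def r_def)
    have "state_elt \<sigma> \<otimes> stable e = prefix_elt st \<otimes> (t [^] n \<otimes> stable e)"
      by (simp add: state_elt_def \<sigma> m_assoc)
    then show ?thesis
      by (simp add: act push state_elt_def m_assoc)
  qed
qed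

lemma state_elt_letter_act: "state_elt (letter_act \<sigma> a) = state_elt \<sigma> \<otimes> letter a"
proof -
  have "t [^] (n + 1) = t [^] n \<otimes> t" "t [^] (n - 1) = t [^] n \<otimes> inv t" for n :: int
    by (simp_all add: int_pow_mult int_pow_diff)
  then show ?thesis
    by (auto simp: letter_act_def letter_def state_elt_stable_act)
      (simp_all add: state_elt_def m_assoc)
qed

end

interpretation BSP: bs_pair "presented_group BS" "word_class BS [(0, True)]" "word_class BS [(Suc 0, True)]"
proof unfold_locales
  show s: "word_class BS [(0, True)] \<in> carrier (presented_group BS)"
    and t: "word_class BS [(Suc 0, True)] \<in> carrier (presented_group BS)"
    by (simp_all add: BS.class_in_carrier)
  have replicate_numeral: "replicate 2 a = [a, a]" "replicate 3 a = [a, a, a]" for a :: "nat letter"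
    by (simp_all add: eval_nat_numeral)
  have pow: "word_class BS [(Suc 0, True)] [^]\<^bsub>presented_group BS\<^esub> int n
      = word_class BS (replicate n (1, True))" for n
  proof (induction n)
    case (Suc n)
    then show ?case
      unfolding int_pow_int using BS.class_mult[of "replicate n (1, True)" "[(1, True)]"]
      by (simp add: replicate_append_same)
  qed (simp add: BS.one_presented_group int_pow_int)
  \<comment> \<open>The word \<open>s r t^3\<close>, with \<open>r\<close> the relator, becomes
    \<open>s t^3\<close> when \<open>r\<close> is deleted and \<open>t^2 s\<close> by free
    reduction; comparing the two gives the relation.\<close>
  have del: "word_equiv BS (([(0, True)] @ bs_relator) @ [(1, True), (1, True), (1, True)])
      ([(0, True)] @ [] @ [(1, True), (1, True), (1, True)])"
    using word_equiv.relator[of "[(0, True)]" "[(1, True), (1, True), (1, True)]" BS bs_relator]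
    by simp
  have "word_equiv BS (([(0, True)] @ bs_relator) @ [(1, True), (1, True), (1, True)])
      [(1, True), (1, True), (0, True)]"
  proof -
    have 1: "word_equiv BS ([] @ [(0, True), (0, False)] @
        [(1, True), (1, True), (0, True), (1, False), (1, False), (1, False), (1, True), (1, True), (1, True)])
       ([] @ [(1, True), (1, True), (0, True), (1, False), (1, False), (1, False), (1, True), (1, True), (1, True)])"
      using word_equiv.trivial[of "[]" _ BS "(0, True)"] by (simp add: inv_letter_def)
    have 2: "word_equiv BS ([(1, True), (1, True), (0, True)] @
        (inv_word (replicate 3 (1, True)) @ replicate 3 (1, True)) @ [])
       ([(1, True), (1, True), (0, True)] @ [] @ [])"
      by (intro BS.equiv_context BS.equiv_inv_left) simp_all
    show ?thesis
      using word_equiv.trans[OF 1[simplified]] 2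
      by (simp add: bs_relator_def eval_nat_numeral inv_letter_def)
  qed
  from word_equiv.trans[OF word_equiv.sym[OF this] del]
  have "word_equiv BS [(1, True), (1, True), (0, True)] [(0, True), (1, True), (1, True), (1, True)]"
    by simp
  then show "word_class BS [(Suc 0, True)] [^]\<^bsub>presented_group BS\<^esub> (2::int)
      \<otimes>\<^bsub>presented_group BS\<^esub> word_class BS [(0, True)] =
    word_class BS [(0, True)] \<otimes>\<^bsub>presented_group BS\<^esub>
      word_class BS [(Suc 0, True)] [^]\<^bsub>presented_group BS\<^esub> (3::int)"
    using pow[of 2] pow[of 3]
    by (simp add: BS.class_mult BS.class_eq_iff replicate_numeral)
qed

lemma BSP_letter:
  assumes "fst a \<in> {0, 1}"
  shows "BSP.letter a = word_class BS [a]"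
proof (cases "snd a")
  case True
  then show ?thesis
    using assms by (cases a) (auto simp: BSP.letter_def BSP.stable_def)
next
  case False
  have "word_class BS (inv_word (gen_word (fst a))) = inv\<^bsub>presented_group BS\<^esub> word_class BS (gen_word (fst a))"
    using assms by (intro BS.class_inv_word) auto
  then show ?thesis
    using False assms by (cases a) (auto simp: BSP.letter_def BSP.stable_def inv_letter_def)
qed

lemma state_elt_normal_form:
  "w \<in> words {0, 1} \<Longrightarrow> BSP.state_elt (normal_form w) = word_class BS w"
proof (induction w rule: rev_induct)
  case Nil
  show ?case
    by (simp add: normal_form_def BSP.state_elt_def BS.one_presented_group[symmetric])
next
  case (snoc a w)
  then have "BSP.state_elt (normal_form (w @ [a]))
      = word_class BS w \<otimes>\<^bsub>presented_group BS\<^esub> word_class BS [a]"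
    by (simp add: normal_form_def BSP.state_elt_letter_act BSP_letter)
  with snoc.prems show ?case by (simp add: BS.class_mult)
qed

text \<open>One direction is invariance under the action; for the other, evaluating the normal form
  recovers the class of the word.\<close>

lemma word_equiv_BS_iff:
  assumes "u \<in> words {0, 1}" "v \<in> words {0, 1}"
  shows "word_equiv BS u v \<longleftrightarrow> normal_form u = normal_form v"
proof
  assume "normal_form u = normal_form v"
  then have "word_class BS u = word_class BS v"
    using state_elt_normal_form assms by metis
  then show "word_equiv BS u v" using assms by (simp add: BS.class_eq_iff)
qed (simp add: normal_form_def word_equiv_act)

lemma class_BS_eq_one_iff:
  assumes "w \<in> words {0, 1}"
  shows "word_class BS w = \<one>\<^bsub>presented_group BS\<^esub> \<longleftrightarrow> normal_form w = ([], 0)"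
  using assms word_equiv_BS_iff[of w "[]"]
  by (simp add: BS.one_presented_group BS.class_eq_iff) (simp add: normal_form_def)

section \<open>A non-Hopfian quotient\<close>

text \<open>The word \<open>s\<^sup>-\<^sup>1 t s t\<^sup>-\<^sup>1\<close>, a preimage of \<open>t\<close> under the surjective endomorphism
  \<open>s \<mapsto> s\<close>, \<open>t \<mapsto> t\<^sup>2\<close> of BS(2,3); killing \<open>hopf_relator\<close> turns this into an isomorphism.\<close>

definition root_word :: "nat word" where
  "root_word = [(0, False), (1, True), (0, True), (1, False)]"

definition hopf_relator :: "nat word" where
  "hopf_relator = root_word @ root_word @ [(1, False)]"

definition hopf_quotient :: "nat presentation" where
  "hopf_quotient = Presentation {0, 1} {bs_relator, hopf_relator}"

lemma gens_hopf_quotient [simp]: "gens hopf_quotient = {0, 1}"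
  by (simp add: hopf_quotient_def)

lemma rels_hopf_quotient [simp]: "rels hopf_quotient = {bs_relator, hopf_relator}"
  by (simp add: hopf_quotient_def)

lemma root_word_in_words [simp]: "root_word \<in> words {0, Suc 0}"
  by (simp add: root_word_def)

lemma hopf_relator_in_words [simp]: "hopf_relator \<in> words {0, Suc 0}"
  by (simp add: hopf_relator_def)

interpretation HQ: wf_presentation hopf_quotient
  by standard simp

text \<open>The action is computed outright. The element is thus nontrivial in BS(2,3), although the
  endomorphism sending \<open>t\<close> to \<open>t^2\<close> kills it.\<close>

lemma normal_form_hopf_relator: "normal_form hopf_relator \<noteq> ([], 0)"
  by (simp add: normal_form_def hopf_relator_def root_word_def letter_act_def stable_act_def index_def)

lemma root_word_square: "word_equiv hopf_quotient (root_word @ root_word) (gen_word 1)"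
proof -
  have "word_equiv hopf_quotient ((root_word @ root_word @ [(1, False)]) @ [(1, True)]) [(1, True)]"
    using word_equiv.relator[of "[]" "[(1, True)]" hopf_quotient hopf_relator]
    by (simp add: hopf_relator_def)
  moreover have "word_equiv hopf_quotient ((root_word @ root_word) @ [(1, False), (1, True)] @ [])
      ((root_word @ root_word) @ [])"
    using word_equiv.trivial[of "root_word @ root_word" "[]" hopf_quotient "(1, False)"]
    by (simp add: inv_letter_def)
  ultimately show ?thesis
    by simp (metis word_equiv.sym word_equiv.trans)
qed

text \<open>Write \<open>a\<close> for \<open>root_word\<close>. As \<open>a^2 = t\<close> in the
  quotient, \<open>s^-1 a^2 s = s^-1 t s = a t = a^3\<close>.\<close>

lemma root_word_relation:
  "word_equiv hopf_quotient ([(0, False)] @ root_word @ root_word @ [(0, True)])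
     (root_word @ root_word @ root_word)"
proof -
  have 1: "word_equiv hopf_quotient ([(0, False)] @ (root_word @ root_word) @ [(0, True)])
      ([(0, False)] @ [(1, True)] @ [(0, True)])"
    by (intro HQ.equiv_context root_word_square) simp_all
  have 2: "word_equiv hopf_quotient (root_word @ [(1, True)]) ([(0, False)] @ [(1, True)] @ [(0, True)])"
    using word_equiv.trivial[of "[(0, False), (1, True), (0, True)]" "[]" hopf_quotient "(1, False)"]
    by (simp add: root_word_def inv_letter_def)
  have 3: "word_equiv hopf_quotient (root_word @ (root_word @ root_word)) (root_word @ [(1, True)])"
    using HQ.equiv_context[OF root_word_square, of root_word "[]"] by simp
  show ?thesis
    using word_equiv.trans[OF 1[simplified] word_equiv.sym[OF word_equiv.trans[OF 3 2, simplified]]]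
    by simp
qed

lemma BS_iso_hopf_quotient: "presented_group BS \<cong> presented_group hopf_quotient"
proof (rule presented_group_iso)
  \<comment> \<open>\<open>g\<close> is the endomorphism sending \<open>t\<close> to
    \<open>t^2\<close>, which factors through the quotient; \<open>f\<close> inverts it, since
    \<open>root_word\<close> is a preimage of \<open>t\<close>.\<close>
  define f g :: "nat \<Rightarrow> nat word"
    where "f x = (if x = 0 then gen_word 0 else root_word)"
      and "g x = (if x = 0 then gen_word 0 else [(1, True), (1, True)])" for x
  show "rels BS \<subseteq> words (gens BS)" "rels hopf_quotient \<subseteq> words (gens hopf_quotient)"
    by simp_all
  show "f x \<in> words (gens hopf_quotient)" "g x \<in> words (gens BS)" for x
    by (simp_all add: f_def g_def)
  have "word_equiv hopf_quotient
      (([(0, False)] @ root_word @ root_word @ [(0, True)]) @ inv_word (root_word @ root_word @ root_word)) []"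
    using HQ.equiv_append[OF root_word_relation word_equiv.refl[of "inv_word (root_word @ root_word @ root_word)"]]
      HQ.equiv_inv_right[of "root_word @ root_word @ root_word"]
    by simp (blast intro: word_equiv.trans)
  then show "word_equiv hopf_quotient (subst f r) []" if "r \<in> rels BS" for r
    using that by (simp add: bs_relator_def subst_Cons f_def inv_letter_def)
  show "word_equiv BS (subst g r) []" if "r \<in> rels hopf_quotient" for r
    using that
    by (auto simp: word_equiv_BS_iff bs_relator_def hopf_relator_def root_word_def subst_Cons g_def inv_letter_def
        normal_form_def letter_act_def stable_act_def index_def)
  show "word_equiv BS (subst g (f x)) (gen_word x)" if "x \<in> gens BS" for x
    using that
    by (auto simp: f_def g_def root_word_def subst_Cons inv_letter_def word_equiv_BS_iff
        normal_form_def letter_act_def stable_act_def index_def)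
  show "word_equiv hopf_quotient (subst f (g x)) (gen_word x)" if "x \<in> gens hopf_quotient" for x
    using that root_word_square
    by (auto simp: f_def g_def subst_Cons word_equiv.refl)
qed

section \<open>The word problem\<close>

lemma computable_stable_act: "computable (stable_act e)"
proof -
  define top where "top st = (if st = [] then (e, 0 :: nat) else hd st)" for st
  have top: "computable (\<lambda>\<sigma> :: state. top (fst \<sigma>))"
    unfolding top_def by (intro computable_hd computable_basic)
  have "computable (\<lambda>\<sigma> :: state.
    if nat (snd \<sigma> mod int (index e)) = 0 \<and> \<not> fst \<sigma> = [] \<and> \<not> fst (top (fst \<sigma>)) = e
    then (tl (fst \<sigma>), int (snd (top (fst \<sigma>))) + int (index (\<not> e)) * (snd \<sigma> div int (index e)))
    else ((e, nat (snd \<sigma> mod int (index e))) # fst \<sigma>,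
      int (index (\<not> e)) * (snd \<sigma> div int (index e))))"
    by (intro computable_If computable_conj computable_not computable_eq computable_Pair
        computable_Cons computable_plus_int computable_times_nat_int computable_div_int
        computable_mod_int computable_nat computable_int computable_tl computable_fst
        computable_snd computable_const computable_id top index_pos)
  moreover have "stable_act e = (\<lambda>\<sigma>.
    if nat (snd \<sigma> mod int (index e)) = 0 \<and> \<not> fst \<sigma> = [] \<and> \<not> fst (top (fst \<sigma>)) = e
    then (tl (fst \<sigma>), int (snd (top (fst \<sigma>))) + int (index (\<not> e)) * (snd \<sigma> div int (index e)))
    else ((e, nat (snd \<sigma> mod int (index e))) # fst \<sigma>,
      int (index (\<not> e)) * (snd \<sigma> div int (index e))))"
    by (rule ext) (auto simp: stable_act_def Let_def top_def)
  ultimately show ?thesis by simp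
qed

lemma computable_normal_form:
  assumes "computable w"
  shows "computable (\<lambda>x. normal_form (w x))"
proof -
  have "computable (\<lambda>z :: 'a \<times> state \<times> nat letter.
    if fst (snd (snd z)) = 0
    then if snd (snd (snd z)) then stable_act True (fst (snd z)) else stable_act False (fst (snd z))
    else (fst (fst (snd z)), snd (fst (snd z)) + (if snd (snd (snd z)) then 1 else - 1)))"
    by (intro computable_If computable_eq_0 computable_compose[OF computable_stable_act]
        computable_Pair computable_plus_int computable_fst computable_snd computable_const computable_id)
  then have "computable (\<lambda>(x :: 'a, \<sigma>, a). letter_act \<sigma> a)"
    by (rule back_subst[of computable]) (auto simp: letter_act_def fun_eq_iff)
  then show ?thesis
    unfolding normal_form_def word_act_def by (intro computable_foldl computable_const assms)
qed

lemma solvable_word_problem_BS: "solvable_word_problem BS"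
proof -
  have "computable (\<lambda>w. if normal_form w = ([], 0) then 1 else 0 :: nat)"
    by (intro computable_If computable_eq computable_normal_form computable_const computable_id)
  from computableE[OF this] obtain d where
    "\<And>w. run d (enc w) = Some (enc (if normal_form w = ([], 0) then 1 else 0 :: nat))"
    by blast
  then have "\<forall>w\<in>words (gens BS). run d (word_code w)
      = Some (if word_class BS w = \<one>\<^bsub>presented_group BS\<^esub> then 1 else 0)"
    by (auto simp: word_code_eq_enc enc_nat_def class_BS_eq_one_iff[simplified])
  then show ?thesis unfolding solvable_word_problem_def by blast
qed

section \<open>Evaluating the output of a Tietze algorithm\<close>

lemma computable_inv_word:
  fixes w :: "'a::encodable \<Rightarrow> 'b::encodable word"
  assumes "computable w"
  shows "computable (\<lambda>x. inv_word (w x))"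
proof -
  have "computable (\<lambda>(x :: 'a, a :: 'b letter). inv_letter a)"
    unfolding inv_letter_def split_def by (intro computable_basic)
  then show ?thesis
    unfolding inv_word_def by (intro computable_rev computable_map assms)
qed

lemma computable_subst:
  fixes f :: "'a::encodable \<Rightarrow> 'b::encodable \<Rightarrow> 'c::encodable word"
  assumes f: "computable (\<lambda>(x, y). f x y)" and w: "computable w"
  shows "computable (\<lambda>x. subst (f x) (w x))"
proof -
  have "computable (\<lambda>z :: 'a \<times> 'b letter. (\<lambda>(x, y). f x y) (fst z, fst (snd z)))"
    by (intro computable_compose[OF f] computable_basic)
  then have "computable (\<lambda>(x, a). if snd a then f x (fst a) else inv_word (f x (fst a)))"
    unfolding split_def
    by (intro computable_If computable_inv_word computable_snd computable_id) auto
  then show ?thesis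
    unfolding subst_def split_def by (intro computable_concat computable_map w) (simp add: split_def)
qed

text \<open>\<open>foldr\<close> treats the head of the list last, so the first match wins, as in
  \<open>map_of\<close>. In this form the lookup is visibly computable.\<close>

lemma replace_gens_foldr:
  "replace_gens ds x = foldr (\<lambda>d r. if fst d = x then snd d else r) ds (gen_word x)"
  by (induction ds) (auto simp: replace_gens_def)

lemma computable_replace_gens:
  fixes ds :: "'a::encodable \<Rightarrow> ('b::encodable \<times> 'b word) list"
  assumes "computable ds" "computable y"
  shows "computable (\<lambda>x. replace_gens (ds x) (y x))"
  unfolding replace_gens_foldr
proof (rule computable_foldr)
  have "computable (\<lambda>z :: 'a \<times> ('b \<times> 'b word) \<times> 'b word. y (fst z))"
    by (intro computable_compose[OF assms(2)] computable_basic)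
  then show "computable (\<lambda>(x, d :: 'b \<times> 'b word, r). if fst d = y x then snd d else r)"
    unfolding split_def by (intro computable_If computable_eq computable_basic)
qed (intro computable_Cons computable_Pair computable_const assms)+

text \<open>A T3 or T4 step at position \<open>n\<close> is the triple of \<open>n\<close>, its tag 3 or 4, and its definitions.
  Only T4 steps change the images of the generators.\<close>

type_synonym steps = "(nat \<times> nat \<times> (nat \<times> nat word) list) list"

definition T4_defs_at :: "steps \<Rightarrow> nat \<Rightarrow> (nat \<times> nat word) list" where
  "T4_defs_at L n = foldr (\<lambda>e r. if fst e = n \<and> fst (snd e) = 4 then snd (snd e) else r) L []"

text \<open>Recomputes \<open>stage_map\<close> from the explicit list of steps alone, without
  running the machine that enumerates the whole sequence.\<close>

definition gen_image :: "steps \<Rightarrow> nat \<Rightarrow> nat \<Rightarrow> nat word" where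
  "gen_image L N x = rec_nat (gen_word x) (\<lambda>n. subst (replace_gens (T4_defs_at L n))) N"

fun step_tag :: "'a tietze \<Rightarrow> nat" where
  "step_tag (T1 ws) = 1"
| "step_tag (T2 ws) = 2"
| "step_tag (T3 ds) = 3"
| "step_tag (T4 ds) = 4"

fun step_defs :: "'a tietze \<Rightarrow> ('a \<times> 'a word) list" where
  "step_defs (T3 ds) = ds"
| "step_defs (T4 ds) = ds"
| "step_defs _ = []"

definition steps_of :: "(nat \<times> nat tietze) list \<Rightarrow> steps" where
  "steps_of L = map (\<lambda>(n, t). (n, step_tag t, step_defs t)) L"

lemma defs_code_eq_enc: "defs_code ds = enc ds"
  by (simp add: defs_code_def enc_list_def[of ds] enc_prod_def enc_nat_def word_code_eq_enc
      split_def cong: map_cong)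

text \<open>The list in the output is thus the code of a value of type \<open>steps\<close>, to
  which functions computable on that type apply.\<close>

lemma steps_code:
  assumes "\<And>n t. (n, t) \<in> set L \<Longrightarrow> changes_generators t"
  shows "list_encode (map (\<lambda>(n, t). prod_encode (n, tietze_code t)) L) = enc (steps_of L)"
proof -
  have "prod_encode (n, tietze_code t) = enc (n, step_tag t, step_defs t)" if "(n, t) \<in> set L" for n t
    using assms[OF that] by (cases t) (simp_all add: enc_Pair enc_nat_def defs_code_eq_enc)
  then show ?thesis
    unfolding enc_list_def steps_of_def by (auto intro!: arg_cong[of _ _ list_encode])
qed

text \<open>The list may repeat an entry, but all T4 entries for one position agree, so taking the
  first match is safe.\<close>

lemma T4_defs_at_unique:
  assumes "(n, 4, ds) \<in> set L" "\<And>ds'. (n, 4, ds') \<in> set L \<Longrightarrow> ds' = ds"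
  shows "T4_defs_at L n = ds"
  using assms
proof (induction L)
  case (Cons e L)
  obtain m k ds' where e: "e = (m, k, ds')" by (cases e)
  show ?case
  proof (cases "m = n \<and> k = 4")
    case True
    with Cons.prems(2)[of ds'] show ?thesis by (simp add: T4_defs_at_def e)
  next
    case False
    with Cons.prems(1) have "(n, 4, ds) \<in> set L" by (auto simp: e)
    from Cons.IH[OF this Cons.prems(2)] False show ?thesis by (auto simp: T4_defs_at_def e)
  qed
qed simp

lemma T4_defs_at_none:
  assumes "\<forall>ds. (n, 4, ds) \<notin> set L"
  shows "T4_defs_at L n = []"
  using assms by (induction L) (auto simp: T4_defs_at_def)

lemma replace_gens_Nil: "replace_gens [] = gen_word"
  by (simp add: replace_gens_def fun_eq_iff)

lemma mem_steps_of_iff: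
  assumes "set L = {(n, t). \<tau> n = Some t \<and> changes_generators t}"
  shows "(n, 4, ds) \<in> set (steps_of L) \<longleftrightarrow> \<tau> n = Some (T4 ds)"
proof -
  have "step_tag t = 4 \<longleftrightarrow> (\<exists>ds. t = T4 ds)" for t :: "nat tietze"
    by (cases t) auto
  then show ?thesis
    using assms unfolding steps_of_def by (force simp: image_iff)
qed

lemma stage_map_step:
  assumes "set L = {(n, t). \<tau> n = Some t \<and> changes_generators t}"
  shows "stage_map \<tau> (Suc n) = subst (replace_gens (T4_defs_at (steps_of L) n)) \<circ> stage_map \<tau> n"
proof (cases "\<exists>ds. \<tau> n = Some (T4 ds)")
  case True
  then obtain ds where ds: "\<tau> n = Some (T4 ds)" by blast
  then have "T4_defs_at (steps_of L) n = ds"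
    by (intro T4_defs_at_unique) (auto simp: mem_steps_of_iff[OF assms])
  with ds show ?thesis by simp
next
  case False
  then have "T4_defs_at (steps_of L) n = []"
    by (intro T4_defs_at_none) (auto simp: mem_steps_of_iff[OF assms])
  moreover have "tietze_map t = gen_word" if "\<tau> n = Some t" for t
    using False that by (cases t) auto
  ultimately show ?thesis
    by (cases "\<tau> n") (auto simp: replace_gens_Nil comp_def)
qed

lemma gen_image_eq_stage_map:
  assumes "set L = {(n, t). \<tau> n = Some t \<and> changes_generators t}"
  shows "gen_image (steps_of L) N = stage_map \<tau> N"
proof (induction N)
  case (Suc N)
  then show ?case
    unfolding stage_map_step[OF assms] by (auto simp: gen_image_def fun_eq_iff)
qed (simp add: gen_image_def fun_eq_iff)

text \<open>A position is bounded by the code of its entry, and this by the code of the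
  list.\<close>

lemma T4_defs_at_beyond:
  assumes "enc L < n"
  shows "T4_defs_at L n = []"
proof (rule T4_defs_at_none, intro allI notI)
  fix ds assume "(n, 4, ds) \<in> set L"
  then have "enc (n, 4 :: nat, ds) \<le> enc L" by (rule enc_le_enc_list)
  moreover have "n \<le> enc (n, 4 :: nat, ds)"
    by (simp add: enc_Pair enc_nat_def le_prod_encode_1)
  ultimately show False using assms by simp
qed

lemma gen_image_stable: "gen_image L (Suc (enc L) + k) = gen_image L (Suc (enc L))"
proof (induction k)
  case (Suc k)
  then show ?case
    by (auto simp: fun_eq_iff gen_image_def T4_defs_at_beyond replace_gens_Nil)
qed simp

text \<open>\<open>Suc (enc L)\<close> is a computable stage past every listed step, so the limit
  map is found without knowing when the sequence has settled.\<close>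

definition limit_image :: "steps \<Rightarrow> nat \<Rightarrow> nat word" where
  "limit_image L = gen_image L (Suc (enc L))"

lemma stage_map_limit:
  assumes L: "set L = {(n, t). \<tau> n = Some t \<and> changes_generators t}"
    and f: "\<forall>\<^sub>F n in sequentially. stage_map \<tau> n = f"
  shows "f = limit_image (steps_of L)"
proof -
  obtain N where N: "\<And>n. n \<ge> N \<Longrightarrow> stage_map \<tau> n = f"
    using f by (auto simp: eventually_sequentially)
  \<comment> \<open>A stage beyond both thresholds: the one for eventual constancy and the one given
    by the code of the list.\<close>
  have "f = stage_map \<tau> (Suc (enc (steps_of L)) + N)"
    by (rule N[symmetric]) simp
  also have "\<dots> = limit_image (steps_of L)"
    unfolding gen_image_eq_stage_map[OF L, symmetric] gen_image_stable limit_image_def ..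
  finally show ?thesis .
qed

lemma computable_T4_defs_at:
  assumes "computable L" "computable n"
  shows "computable (\<lambda>x. T4_defs_at (L x) (n x))"
  unfolding T4_defs_at_def
proof (rule computable_foldr)
  have "computable (\<lambda>z :: 'a \<times> (nat \<times> nat \<times> (nat \<times> nat word) list) \<times> (nat \<times> nat word) list. n (fst z))"
    by (intro computable_compose[OF assms(2)] computable_basic)
  then show "computable (\<lambda>(x, e :: nat \<times> nat \<times> (nat \<times> nat word) list, r).
      if fst e = n x \<and> fst (snd e) = 4 then snd (snd e) else r)"
    unfolding split_def
    by (intro computable_If computable_conj computable_eq computable_fst computable_snd
        computable_const computable_id)
qed (intro computable_const assms)+

lemma computable_limit_image: "computable (\<lambda>(L, x). limit_image L x)"
  unfolding split_def limit_image_def gen_image_def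
proof (rule computable_rec_nat)
  show "computable (\<lambda>(z :: steps \<times> nat, n, r). subst (replace_gens (T4_defs_at (fst z) n)) r)"
    unfolding split_def
    by (rule computable_subst)
      (auto simp: split_def intro!: computable_replace_gens computable_T4_defs_at computable_basic)
qed (intro computable_Cons computable_Pair computable_enc computable_basic)+

text \<open>Every number is read as a word in \<open>s\<close> and \<open>t\<close>, so that unbounded search runs through all of them.\<close>

definition word_of_nat :: "nat \<Rightarrow> nat word" where
  "word_of_nat n =
    map (\<lambda>c. (if fst (prod_decode c) = 0 then 0 else 1, snd (prod_decode c) \<noteq> 0)) (list_decode n)"

lemma word_of_nat_in_words: "word_of_nat n \<in> words {0, 1}"
proof -
  have "map (\<lambda>c. (if p c then 0 else 1, q c)) xs \<in> words {0, 1}"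
    for p q :: "nat \<Rightarrow> bool" and xs
    by (induction xs) auto
  then show ?thesis unfolding word_of_nat_def .
qed

lemma word_of_nat_enc:
  assumes "w \<in> words {0, 1}"
  shows "word_of_nat (enc w) = w"
  using assms
  by (induction w) (auto simp: word_of_nat_def enc_list_def enc_prod_def enc_nat_def enc_bool_def)

lemma computable_word_of_nat:
  assumes "computable n"
  shows "computable (\<lambda>x. word_of_nat (n x))"
  unfolding word_of_nat_def
  by (intro computable_map computable_compose[OF computable_list_decode assms])
    (unfold split_def, intro computable_Pair computable_If computable_not computable_eq_0
      computable_fst computable_snd computable_compose[OF computable_prod_decode] computable_const computable_id)

text \<open>A nontrivial word mapped to \<open>hopf_relator\<close> exists if the limit map is an automorphism of
  BS(2,3), but not if it is an isomorphism onto \<open>hopf_quotient\<close>.\<close>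

definition hopf_witness :: "steps \<Rightarrow> nat word \<Rightarrow> bool" where
  "hopf_witness L z \<longleftrightarrow> normal_form (subst (limit_image L) z) = normal_form hopf_relator
    \<and> normal_form z \<noteq> ([], 0)"

text \<open>The witness is a preimage of \<open>hopf_relator\<close> under the automorphism; if it
  were trivial, so would be \<open>hopf_relator\<close>.\<close>

lemma hopf_witness_exists:
  assumes "extends_to_iso BS BS (limit_image L)"
  shows "\<exists>z \<in> words {0, 1}. hopf_witness L z"
proof -
  obtain h where h: "h \<in> iso (presented_group BS) (presented_group BS)"
    and hf: "\<And>x. x \<in> gens BS \<Longrightarrow> h (word_class BS (gen_word x)) = word_class BS (limit_image L x)"
    using assms by (auto simp: extends_to_iso_def)
  have "word_class BS hopf_relator \<in> h ` carrier (presented_group BS)"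
    using h BS.class_in_carrier[of hopf_relator] by (simp add: iso_def bij_betw_def)
  then obtain z where z: "z \<in> words (gens BS)" "word_class BS hopf_relator = h (word_class BS z)"
    by (auto elim: BS.in_carrierE)
  note img = iso_class_subst[OF BS.rels_subset BS.rels_subset h hf z(1)]
  have eq: "word_equiv BS (subst (limit_image L) z) hopf_relator"
    using z(2) img(2) by (intro word_equiv.sym[OF BS.class_eq_iff[THEN iffD1]]) simp_all
  have "normal_form z \<noteq> ([], 0)"
  proof
    assume "normal_form z = ([], 0)"
    then have "word_class BS z = word_class BS []"
      using z(1) by (simp flip: class_BS_eq_one_iff add: BS.one_presented_group)
    then have "word_class BS [] = word_class BS (subst (limit_image L) z)"
      using img(2) iso_class_subst(2)[OF BS.rels_subset BS.rels_subset h hf, of "[]"]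
      by simp
    then have "word_equiv BS [] (subst (limit_image L) z)"
      by (rule BS.class_eq_iff[THEN iffD1, rotated]) simp
    from word_equiv.trans[OF this eq] show False
      using normal_form_hopf_relator by (simp add: word_equiv_BS_iff) (simp add: normal_form_def)
  qed
  moreover have "normal_form (subst (limit_image L) z) = normal_form hopf_relator"
    using eq img(1) by (simp add: word_equiv_BS_iff)
  ultimately show ?thesis using z(1) by (auto simp: hopf_witness_def)
qed

lemma word_equiv_BS_imp_hopf_quotient:
  "word_equiv BS u v \<Longrightarrow> word_equiv hopf_quotient u v"
  using subst_equiv[of hopf_quotient BS gen_word u v]
    word_equiv.relator[of "[]" "[]" hopf_quotient bs_relator]
  by simp

text \<open>In the quotient \<open>hopf_relator\<close> is trivial, so injectivity forces every word
  mapped to it to be trivial already in BS(2,3).\<close>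

lemma no_hopf_witness:
  assumes iso: "extends_to_iso BS hopf_quotient (limit_image L)" and z: "z \<in> words {0, 1}"
  shows "\<not> hopf_witness L z"
proof
  assume wit: "hopf_witness L z"
  obtain h where h: "h \<in> iso (presented_group BS) (presented_group hopf_quotient)"
    and hf: "\<And>x. x \<in> gens BS \<Longrightarrow>
      h (word_class BS (gen_word x)) = word_class hopf_quotient (limit_image L x)"
    using iso by (auto simp: extends_to_iso_def)
  have z': "z \<in> words (gens BS)" using z by simp
  note img = iso_class_subst[OF BS.rels_subset HQ.rels_subset h hf]
  have "word_equiv BS (subst (limit_image L) z) hopf_relator"
    using wit img(1)[OF _ z'] by (simp add: hopf_witness_def word_equiv_BS_iff)
  then have "word_equiv hopf_quotient (subst (limit_image L) z) hopf_relator"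
    by (rule word_equiv_BS_imp_hopf_quotient)
  moreover have "word_equiv hopf_quotient hopf_relator []"
    using word_equiv.relator[of "[]" "[]" hopf_quotient hopf_relator] by simp
  ultimately have "word_equiv hopf_quotient (subst (limit_image L) z) []"
    by (rule word_equiv.trans)
  then have "h (word_class BS z) = h (word_class BS [])"
    using img[OF _ z'] img(2)[of "[]"] by (simp add: HQ.class_eq_iff)
  moreover have "inj_on h (carrier (presented_group BS))"
    using h by (simp add: iso_def bij_betw_def)
  ultimately have "word_class BS z = word_class BS []"
    using z BS.class_in_carrier[of z] BS.class_in_carrier[of "[]"] by (auto dest: inj_onD)
  then show False
    using wit z by (simp add: hopf_witness_def flip: class_BS_eq_one_iff BS.one_presented_group)
qed

lemma computable_hopf_witness:
  "computable (\<lambda>(y :: nat \<times> steps, n). hopf_witness (snd y) (word_of_nat n))"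
proof -
  have "computable (\<lambda>u :: ((nat \<times> steps) \<times> nat) \<times> nat.
      (\<lambda>(L, x). limit_image L x) (snd (fst (fst u)), snd u))"
    by (intro computable_compose[OF computable_limit_image] computable_basic)
  then have "computable (\<lambda>z :: (nat \<times> steps) \<times> nat.
      subst (limit_image (snd (fst z))) (word_of_nat (snd z)))"
    by (intro computable_subst computable_word_of_nat computable_basic) (simp add: split_def)
  then show ?thesis
    unfolding hopf_witness_def split_def
    by (intro computable_conj computable_not computable_eq computable_normal_form
        computable_word_of_nat computable_snd computable_const computable_id)
qed

lemma search_machine:
  fixes c :: "'a::encodable \<Rightarrow> nat \<Rightarrow> bool"
  assumes "computable (\<lambda>(y, n). c y n)"
  obtains m where "\<And>y. run m (enc y) \<noteq> None \<longleftrightarrow> (\<exists>n. c y n)"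
proof -
  \<comment> \<open>\<open>Minim\<close> looks for a zero, so 0 stands for success; as the test is
    total, no undefined earlier value blocks the search.\<close>
  have "computable (\<lambda>z. if (\<lambda>(y, n). c y n) z then 0 else 1 :: nat)"
    by (intro computable_If assms computable_const)
  from computableE[OF this] obtain p where
    "\<And>z. run p (enc z) = Some (enc (if (\<lambda>(y, n). c y n) z then 0 else 1 :: nat))"
    by blast
  from this[of "(_, _)"] have "run p (prod_encode (enc y, n)) = Some (if c y n then 0 else 1)" for y n
    by (simp add: enc_Pair enc_nat_def)
  then have "run (Minim p) (enc y) \<noteq> None \<longleftrightarrow> (\<exists>n. c y n)" for y
    by simp
  then show thesis by (rule that)
qed

section \<open>Diagonalization\<close>

text \<open>Enumerates the relators of BS(2,3), or of \<open>hopf_quotient\<close> if \<open>M\<close> halts on its own code.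
  While \<open>M\<close> runs no further output appears, so no step counting is needed.\<close>

definition enumerator :: "machine \<Rightarrow> machine" where
  "enumerator M =
    Compose (PrimRec (const_machine (enc bs_relator))
        (Compose (const_machine (enc hopf_relator)) (Compose M (const_machine (machine_code M)))))
      (Pairing Zero (Pairing Proj1 Proj2))"

lemma run_enumerator:
  "run (enumerator M) n = (if n = 0 then Some (enc bs_relator)
     else map_option (\<lambda>_. enc hopf_relator) (run M (machine_code M)))"
proof -
  \<comment> \<open>Each round needs the previous value only to be defined, and runs
    \<open>M\<close> on its own code anew. So the sequence either has one item or is infinite and
    repeats \<open>hopf_relator\<close>.\<close>
  have "rec_nat (Some a) (\<lambda>k r. Option.bind r (\<lambda>y. map_option (\<lambda>_. b) m)) n
    = (if n = 0 then Some a else map_option (\<lambda>_. b) m)" for a b :: nat and m :: "nat option"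
    by (induction n) (auto simp: Option.bind_eq_None_conv map_option_case split: option.split)
  moreover have "Option.bind m (\<lambda>_. Some b) = map_option (\<lambda>_. b) m" for m :: "nat option" and b :: nat
    by (cases m) auto
  ultimately show ?thesis by (simp add: enumerator_def run_const_machine[abs_def])
qed

definition diagonal_presentation :: "machine \<Rightarrow> nat presentation" where
  "diagonal_presentation M = (if run M (machine_code M) = None then BS else hopf_quotient)"

lemma recursive_diagonal_presentation:
  "recursive_presentation (diagonal_presentation M) (enumerator M)"
proof -
  define \<rho> where "\<rho> n = (if n = 0 then Some bs_relator
    else if run M (machine_code M) = None then None else Some hopf_relator)" for n :: nat
  have "enumerates (enumerator M) word_code \<rho>"
    by (auto simp: enumerates_def is_sequence_def \<rho>_def run_enumerator word_code_eq_enc)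
  moreover have "ran \<rho> = rels (diagonal_presentation M)"
    unfolding \<rho>_def ran_def diagonal_presentation_def by auto
  ultimately show ?thesis
    unfolding recursive_presentation_def
    by (auto simp: diagonal_presentation_def)
qed

lemma BS_iso_diagonal_presentation:
  "presented_group BS \<cong> presented_group (diagonal_presentation M)"
  using BS_iso_hopf_quotient by (simp add: diagonal_presentation_def iso_refl)

lemma computable_diagonal_code:
  obtains H where "\<And>M. run H (machine_code M)
    = Some (presentation_code (diagonal_presentation M) (enumerator M))"
proof -
  have pe: "computable (\<lambda>x. prod_encode (f x, g x))"
    if "computable f" "computable g" for f g :: "nat \<Rightarrow> nat"
    using computable_compose[OF computable_prod_encode computable_Pair[OF that]] .
  \<comment> \<open>The enumerator contains the code of \<open>M\<close> as a constant machine, so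
    the code of that machine must be computable from the constant.\<close>
  have const: "computable (\<lambda>k. machine_code (const_machine k))"
  proof -
    have "computable (\<lambda>k. rec_nat (prod_encode (0, 0))
        (\<lambda>_ r. prod_encode (5, prod_encode (prod_encode (1, 0), r))) k)"
    proof (rule computable_rec_nat)
      show "computable (\<lambda>(x :: nat, k :: nat, r). prod_encode (5, prod_encode (prod_encode (1, 0), r)))"
        unfolding split_def
        by (intro computable_compose[OF computable_prod_encode] computable_basic)
    qed (rule computable_const computable_id)+
    moreover have "rec_nat (prod_encode (0, 0))
        (\<lambda>_ r. prod_encode (5, prod_encode (prod_encode (1, 0), r))) k = machine_code (const_machine k)" for k
      by (induction k) auto
    ultimately show ?thesis by simp
  qed
  \<comment> \<open>\<open>E\<close> follows the syntax tree of \<open>enumerator M\<close>, with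
    \<open>x\<close> for the code of \<open>M\<close>; 5 and 6 are the tags of
    \<open>Compose\<close> and \<open>PrimRec\<close>.\<close>
  define E where "E x = prod_encode (5, prod_encode (
      prod_encode (6, prod_encode (machine_code (const_machine (enc bs_relator)),
        prod_encode (5, prod_encode (machine_code (const_machine (enc hopf_relator)),
          prod_encode (5, prod_encode (x, machine_code (const_machine x))))))),
      machine_code (Pairing Zero (Pairing Proj1 Proj2))))" for x
  have E: "E (machine_code M) = machine_code (enumerator M)" for M
    by (simp add: E_def enumerator_def)
  \<comment> \<open>Both possible values of \<open>diagonal_presentation M\<close> have the
    generators 0 and 1, so the input for the algorithm can be written down without deciding whether
    \<open>M\<close> halts.\<close>
  have "computable (\<lambda>x. prod_encode (list_encode (sorted_list_of_set {0, 1}), E x))"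
    unfolding E_def by (intro pe const computable_const computable_id)
  from computableE[OF this[folded enc_nat_def]] obtain H where
    "\<And>x. run H x = Some (prod_encode (list_encode (sorted_list_of_set {0, 1}), E x))"
    unfolding enc_nat_def by blast
  then have "run H (machine_code M)
      = Some (presentation_code (diagonal_presentation M) (enumerator M))" for M
    by (simp add: E presentation_code_def diagonal_presentation_def)
  then show thesis by (rule that)
qed

lemma no_tietze_algorithm_BS: "\<not> tietze_algorithm BS A"
proof
  assume A: "tietze_algorithm BS A"
  obtain H where H: "\<And>M. run H (machine_code M)
    = Some (presentation_code (diagonal_presentation M) (enumerator M))"
    by (rule computable_diagonal_code) blast
  obtain m where m: "\<And>y :: nat \<times> steps. run m (enc y) \<noteq> None
      \<longleftrightarrow> (\<exists>n. hopf_witness (snd y) (word_of_nat n))"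
    by (rule search_machine[OF computable_hopf_witness]) blast
  \<comment> \<open>Given the code of a machine, \<open>B\<close> builds the diagonal presentation,
    asks \<open>A\<close> for a sequence and searches for a witness. Below it is applied to its own
    code.\<close>
  define B where "B = Compose m (Compose A H)"
  have run_B: "run B x = Option.bind (Option.bind (run H x) (run A)) (run m)" for x
    by (simp add: B_def)
  obtain y \<tau> where y: "run A (presentation_code (diagonal_presentation B) (enumerator B)) = Some y"
    and spec: "specifies_sequence y \<tau>" and tr: "transforms BS \<tau> (diagonal_presentation B)"
    using A recursive_diagonal_presentation BS_iso_diagonal_presentation
    unfolding tietze_algorithm_def by blast
  obtain e L where y_code: "y = prod_encode (machine_code e,
        list_encode (map (\<lambda>(n, t). prod_encode (n, tietze_code t)) L))"
    and L: "set L = {(n, t). \<tau> n = Some t \<and> changes_generators t}"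
    using spec unfolding specifies_sequence_def by blast
  have "y = enc (machine_code e, steps_of L)"
    unfolding y_code by (subst steps_code) (auto simp: L enc_Pair enc_nat_def)
  then have halts: "run B (machine_code B) \<noteq> None
      \<longleftrightarrow> (\<exists>n. hopf_witness (steps_of L) (word_of_nat n))"
    using m[of "(machine_code e, steps_of L)"] by (simp add: run_B H y)
  obtain f where f: "\<forall>\<^sub>F n in sequentially. stage_map \<tau> n = f"
    and iso: "extends_to_iso BS (diagonal_presentation B) f"
    using tr unfolding transforms_def by blast
  have "f = limit_image (steps_of L)"
    using L f by (rule stage_map_limit)
  note iso = iso[unfolded this]
  show False
  proof (cases "run B (machine_code B) = None")
    case True
    with iso have "extends_to_iso BS BS (limit_image (steps_of L))"
      by (simp add: diagonal_presentation_def)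
    then obtain z where "z \<in> words {0, 1}" "hopf_witness (steps_of L) z"
      using hopf_witness_exists by blast
    then have "hopf_witness (steps_of L) (word_of_nat (enc z))"
      by (simp only: word_of_nat_enc)
    with halts True show False by blast
  next
    case False
    with iso have "extends_to_iso BS hopf_quotient (limit_image (steps_of L))"
      by (simp add: diagonal_presentation_def)
    then have "\<not> hopf_witness (steps_of L) (word_of_nat n)" for n
      using no_hopf_witness word_of_nat_in_words by blast
    with halts False show False by blast
  qed
qed

theorem lemma4p4:
  shows "finite_presentation (baumslag_solitar 2 3) \<and>
    solvable_word_problem (baumslag_solitar 2 3) \<and>
    \<not> (\<exists>A. tietze_algorithm (baumslag_solitar 2 3) A)"
  using finite_presentation_BS solvable_word_problem_BS no_tietze_algorithm_BS by blast

end
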